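(* For $0\le t<1$ and periods $p,p_1,p_2$: (1) $\zeta_0(t)=1$, and if $p$ is a nonzero algebraic number then $\zeta_p(t)=\frac{1}{1-t}$; (2) $\zeta_{p_1p_2}(t)\le\zeta_{p_1}(t)\,\zeta_{p_2}(t)$; (3) $\zeta_p(t)\le\exp\!\left(\frac{t\deg(p)}{1-t}\right)$; (4) if $\deg(p_1)\le\deg(p_2)$, then $\zeta_{p_1+p_2}(t)\le\exp\!\left(\frac{t\deg(p_2)}{1-t}\right)$.
   Context: Let $\overline{\mathbb{Q}}$ denote the field of algebraic numbers. For $n\ge 1$, an admissible domain in $\mathbb{R}^n$ is a subset of $\mathbb{R}^n$ which is a finite union of sets of the form $\{x\in\mathbb{R}^n : P_1(x)\,\square_1\, 0,\dots,P_r(x)\,\square_r\, 0\}$, where each $P_i$ is a polynomial with real algebraic coefficients and each $\square_i\in\{\ge,>\}$, and which has finite Lebesgue measure $\mathrm{vol}_n$. A real number $p$ is a real period if $p=\mathrm{vol}_n(\Sigma_1)-\mathrm{vol}_n(\Sigma_2)$ for some $n\ge1$ and admissible domains $\Sigma_1,\Sigma_2\subseteq\mathbb{R}^n$; a complex number is a period if its real and imaginary parts are real periods. The degree is defined as follows: $\deg(0)=0$; for a nonzero real period $p$, $\deg(p)$ is the least $n\ge 1$ such that $p=\mathrm{vol}_n(\Sigma_1)-\mathrm{vol}_n(\Sigma_2)$ with $\Sigma_1,\Sigma_2$ admissible domains in $\mathbb{R}^n$; for a complex period $p=a+ib$ ($a,b$ real), $\deg(p)=\max(\deg(a),\deg(b))$.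 For a period $p$ and $0\le t<1$, the zeta function of $p$ is $\zeta_p(t)=\exp\!\left(\sum_{m=1}^{\infty}\frac{t^m\deg(p^m)}{m}\right)$. *)

theory Defs
  imports "HOL-Analysis.Analysis" "HOL-Computational_Algebra.Polynomial"
begin

text \<open>Points of R^n are represented as functions nat => real in PiE {..<n} UNIV
  (coordinates 0..n-1, value undefined elsewhere); Lebesgue measure on R^n is the
  product measure of n copies of lborel.\<close>

definition lebesgue_n :: "nat \<Rightarrow> (nat \<Rightarrow> real) measure" where
  "lebesgue_n n = PiM {..<n} (\<lambda>_. lborel)"

definition vol_n :: "nat \<Rightarrow> (nat \<Rightarrow> real) set \<Rightarrow> real" where
  "vol_n n S = measure (lebesgue_n n) S"

definition alg_poly_fun :: "nat \<Rightarrow> ((nat \<Rightarrow> real) \<Rightarrow> real) \<Rightarrow> bool" where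
  "alg_poly_fun n P \<longleftrightarrow>
     (\<exists>c :: (nat \<Rightarrow> nat) \<Rightarrow> real.
        finite {\<alpha>. c \<alpha> \<noteq> 0} \<and>
        (\<forall>\<alpha>. c \<alpha> \<noteq> 0 \<longrightarrow> algebraic (c \<alpha>) \<and> (\<forall>i\<ge>n. \<alpha> i = 0)) \<and>
        (\<forall>x. P x = (\<Sum>\<alpha>\<in>{\<alpha>. c \<alpha> \<noteq> 0}. c \<alpha> * (\<Prod>i<n. x i ^ \<alpha> i))))"

definition basic_set :: "nat \<Rightarrow> (((nat \<Rightarrow> real) \<Rightarrow> real) \<times> bool) list \<Rightarrow> (nat \<Rightarrow> real) set" where
  "basic_set n L = {x \<in> PiE {..<n} (\<lambda>_. UNIV).
      \<forall>(P, strict) \<in> set L. (if strict then P x > 0 else P x \<ge> 0)}"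

definition admissible :: "nat \<Rightarrow> (nat \<Rightarrow> real) set \<Rightarrow> bool" where
  "admissible n S \<longleftrightarrow>
     (\<exists>Ls :: (((nat \<Rightarrow> real) \<Rightarrow> real) \<times> bool) list list.
        (\<forall>L \<in> set Ls. \<forall>(P, _) \<in> set L. alg_poly_fun n P) \<and>
        S = (\<Union>L \<in> set Ls. basic_set n L)) \<and>
     emeasure (lebesgue_n n) S < \<infinity>"

definition real_period_dim :: "nat \<Rightarrow> real \<Rightarrow> bool" where
  "real_period_dim n p \<longleftrightarrow>
     (\<exists>S1 S2. admissible n S1 \<and> admissible n S2 \<and> p = vol_n n S1 - vol_n n S2)"

definition real_period :: "real \<Rightarrow> bool" where
  "real_period p \<longleftrightarrow> (\<exists>n\<ge>1. real_period_dim n p)"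

definition period :: "complex \<Rightarrow> bool" where
  "period z \<longleftrightarrow> real_period (Re z) \<and> real_period (Im z)"

definition real_deg :: "real \<Rightarrow> nat" where
  "real_deg p = (if p = 0 then 0 else (LEAST n. n \<ge> 1 \<and> real_period_dim n p))"

definition deg :: "complex \<Rightarrow> nat" where
  "deg z = max (real_deg (Re z)) (real_deg (Im z))"

definition period_zeta :: "complex \<Rightarrow> real \<Rightarrow> real" where
  "period_zeta p t =
     exp (\<Sum>m. t ^ Suc m * real (deg (p ^ Suc m)) / real (Suc m))"

end

theory Submission
  imports Defs
begin

text \<open>
  Everything reduces to three facts about the degree: \<^term>\<open>deg (p * q) \<le> deg p + deg q\<close>,
  \<^term>\<open>deg (p + q) \<le> max (deg p) (deg q)\<close>, and \<^term>\<open>deg p = 1\<close> for nonzero algebraic \<open>p\<close>;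
  the zeta function is then compared term by term with a geometric series or with
  \<open>- ln (1 - t)\<close>. Products of periods come from cartesian products of domains. Sums need disjoint
  copies of two domains in the same dimension, which is not immediate because a domain of finite
  volume may be unbounded. In dimension \<open>1\<close> it is bounded, as a polynomial has eventually constant
  sign. In dimension at least \<open>2\<close> the part with \<open>\<bar>x\<^sub>0\<bar> > 1\<close> is moved into \<open>\<bar>x\<^sub>0\<bar> < 1\<close> by the
  volume-preserving map \<open>(x\<^sub>0, x\<^sub>1, x\<^sub>2, \<dots>) \<mapsto> (- 1 / x\<^sub>0, x\<^sub>0\<^sup>2 x\<^sub>1, x\<^sub>2, \<dots>)\<close>. Once both domains are
  bounded in the direction of \<open>x\<^sub>0\<close>, a translation makes them disjoint.
\<close>

subsection \<open>Algebraic numbers\<close>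

lemma vector_space_of_rat: "vector_space (\<lambda>q (x::'a::field_char_0). of_rat q * x)"
  by standard (simp_all add: algebra_simps of_rat_add of_rat_mult)

text \<open>If \<open>B\<close> has \<open>N\<close> elements, the \<open>N + 1\<close> powers of
  \<open>z\<close> up to exponent \<open>N\<close> are linearly dependent over the rationals, and a
  dependence is a rational polynomial vanishing at \<open>z\<close>. This is the source of all
  closure properties below.\<close>

lemma algebraic_if_finite_span:
  fixes z :: "'a::field_char_0"
  assumes "finite B"
    and pow: "\<And>k. z ^ k \<in> module.span (\<lambda>q (x::'a). of_rat q * x) B"
  shows "algebraic z"
proof -
  interpret Q: vector_space "\<lambda>q (x::'a). of_rat q * x" by (rule vector_space_of_rat)
  define N where "N = card B"
  show ?thesis
  \<comment> \<open>Dependence speaks about the set of powers, so its coefficients can be read off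
    by exponent only when the powers are distinct. Two equal powers give the annihilating polynomial
    \<open>monom 1 i - monom 1 j\<close> directly.\<close>
  proof (cases "inj_on (\<lambda>k. z ^ k) {..N}")
    case True
    define S where "S = (\<lambda>k. z ^ k) ` {..N}"
    have "card S = Suc N" using True by (simp add: S_def card_image)
    moreover have "S \<subseteq> Q.span B" using pow by (auto simp: S_def)
    ultimately have "Q.dependent S"
      using Q.independent_span_bound[OF assms(1)] by (metis N_def not_less_eq_eq le_refl)
    then obtain u v where uv: "v \<in> S" "u v \<noteq> 0" "(\<Sum>v\<in>S. of_rat (u v) * v) = 0"
      using Q.dependent_finite[of S] by (auto simp: S_def)
    define p :: "'a poly" where "p = (\<Sum>k\<le>N. monom (of_rat (u (z ^ k))) k)"
    have c: "coeff p i = (if i \<le> N then of_rat (u (z ^ i)) else 0)" for i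
      by (simp add: p_def coeff_sum if_distrib cong: if_cong)
    have "poly p z = (\<Sum>k\<le>N. of_rat (u (z ^ k)) * z ^ k)"
      by (simp add: p_def poly_sum poly_monom)
    also have "\<dots> = (\<Sum>v\<in>S. of_rat (u v) * v)"
      unfolding S_def by (subst sum.reindex[OF True]) simp
    finally have "poly p z = 0" using uv by simp
    moreover have "p \<noteq> 0"
    proof -
      obtain k where "k \<le> N" "v = z ^ k" using uv(1) by (auto simp: S_def)
      then have "coeff p k \<noteq> 0" using uv(2) c by simp
      then show ?thesis by auto
    qed
    ultimately show ?thesis by (intro algebraicI'[of p]) (auto simp: c)
  next
    case False
    then obtain i j where ij: "i \<noteq> j" "z ^ i = z ^ j" by (auto simp: inj_on_def)
    define p :: "'a poly" where "p = monom 1 i - monom 1 j"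
    have "coeff p i = 1" using ij by (simp add: p_def)
    then have "p \<noteq> 0" by auto
    moreover have "poly p z = 0" using ij by (simp add: p_def poly_monom)
    ultimately show ?thesis by (intro algebraicI'[of p]) (auto simp: p_def)
  qed
qed

text \<open>Dividing an integer equation for \<open>x\<close> by its leading coefficient writes
  \<open>x ^ n\<close> through lower powers; by strong induction every power then reduces to the
  first \<open>n\<close> ones.\<close>

lemma algebraic_powers_finite_span:
  fixes x :: "'a::field_char_0"
  assumes "algebraic x"
  obtains A where "finite A" "\<And>k. x ^ k \<in> module.span (\<lambda>q (x::'a). of_rat q * x) A"
proof -
  interpret Q: vector_space "\<lambda>q (x::'a). of_rat q * x" by (rule vector_space_of_rat)
  obtain p where p: "p \<noteq> 0" "poly (map_poly of_int p) x = 0"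
    using assms by (erule algebraicE')
  define n where "n = degree p"
  define A where "A = (\<lambda>i. x ^ i) ` {..<n}"
  define q :: "nat \<Rightarrow> rat" where "q i = - (of_int (coeff p i) / of_int (coeff p n))" for i
  have lc: "coeff p n \<noteq> 0" using p(1) by (simp add: n_def)
  have "(\<Sum>i\<le>n. of_int (coeff p i) * x ^ i) = 0"
    using p(2) by (simp add: poly_altdef coeff_map_poly degree_map_poly n_def)
  then have "of_int (coeff p n) * x ^ n = - (\<Sum>i<n. of_int (coeff p i) * x ^ i)"
    by (simp add: lessThan_Suc_atMost[symmetric] add_eq_0_iff2)
  then have "x ^ n = - (\<Sum>i<n. of_int (coeff p i) * x ^ i) / of_int (coeff p n)"
    using lc by (simp add: field_simps)
  also have "\<dots> = (\<Sum>i<n. - (of_int (coeff p i) / of_int (coeff p n)) * x ^ i)"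
    by (simp add: sum_divide_distrib sum_negf)
  also have "\<dots> = (\<Sum>i<n. of_rat (- (of_int (coeff p i) / of_int (coeff p n))) * x ^ i)"
    by (simp add: of_rat_minus of_rat_divide)
  finally have q: "x ^ n = (\<Sum>i<n. of_rat (q i) * x ^ i)" by (simp add: q_def)
  have "x ^ k \<in> Q.span A" for k
  proof (induction k rule: less_induct)
    case (less k)
    show ?case
    proof (cases "k < n")
      case True
      then show ?thesis by (auto simp: A_def intro!: Q.span_base)
    next
      case False
      then have "x ^ k = x ^ (k - n) * x ^ n" by (simp add: power_add[symmetric])
      also have "\<dots> = (\<Sum>i<n. of_rat (q i) * x ^ (k - n + i))"
        by (simp add: q sum_distrib_left power_add algebra_simps)
      also have "\<dots> \<in> Q.span A"
        using False less.IH by (intro Q.span_sum Q.span_scale) auto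
      finally show ?thesis .
    qed
  qed
  then show ?thesis using that[of A] by (simp add: A_def)
qed

text \<open>The pairwise products of two spanning sets span all mixed monomials, by bilinearity.
  Powers of both \<open>x + y\<close> and \<open>x * y\<close> lie in this one span.\<close>

lemma algebraic_common_finite_span:
  fixes x y :: "'a::field_char_0"
  assumes "algebraic x" "algebraic y"
  obtains C where "finite C" "\<And>i j. x ^ i * y ^ j \<in> module.span (\<lambda>q (x::'a). of_rat q * x) C"
proof -
  interpret Q: vector_space "\<lambda>q (x::'a). of_rat q * x" by (rule vector_space_of_rat)
  obtain A where A: "finite A" "\<And>k. x ^ k \<in> Q.span A"
    using algebraic_powers_finite_span[OF assms(1)] by blast
  obtain B where B: "finite B" "\<And>k. y ^ k \<in> Q.span B"
    using algebraic_powers_finite_span[OF assms(2)] by blast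
  define C where "C = (\<lambda>(a, b). a * b) ` (A \<times> B)"
  have 1: "a * b \<in> Q.span C" if "a \<in> A" "b \<in> Q.span B" for a b
    using that(2)
  proof (induction rule: Q.span_induct_alt)
    case (step c v w)
    have "a * v \<in> Q.span C" using that(1) step(1) by (auto simp: C_def intro!: Q.span_base)
    from Q.span_add[OF Q.span_scale[OF this, of c] step(2)]
    show ?case by (simp add: algebra_simps)
  qed (simp add: Q.span_zero)
  have 2: "a * b \<in> Q.span C" if "a \<in> Q.span A" "b \<in> Q.span B" for a b
    using that(1)
  proof (induction rule: Q.span_induct_alt)
    case (step c v w)
    from Q.span_add[OF Q.span_scale[OF 1[OF step(1) that(2)], of c] step(2)]
    show ?case by (simp add: algebra_simps)
  qed (simp add: Q.span_zero)
  show ?thesis using that[of C] A B 2 by (simp add: C_def)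
qed

lemma algebraic_add:
  fixes x y :: "'a::field_char_0"
  assumes "algebraic x" "algebraic y"
  shows "algebraic (x + y)"
proof -
  interpret Q: vector_space "\<lambda>q (x::'a). of_rat q * x" by (rule vector_space_of_rat)
  obtain C where C: "finite C" "\<And>i j. x ^ i * y ^ j \<in> Q.span C"
    using algebraic_common_finite_span[OF assms] by blast
  have "(x + y) ^ k \<in> Q.span C" for k
  proof -
    have "(x + y) ^ k = (\<Sum>i\<le>k. of_rat (of_nat (k choose i)) * (x ^ i * y ^ (k - i)))"
      by (simp add: binomial_ring mult.assoc)
    also have "\<dots> \<in> Q.span C" by (intro Q.span_sum Q.span_scale C)
    finally show ?thesis .
  qed
  then show ?thesis using algebraic_if_finite_span C(1) by blast
qed

lemma algebraic_mult:
  fixes x y :: "'a::field_char_0"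
  assumes "algebraic x" "algebraic y"
  shows "algebraic (x * y)"
proof -
  interpret Q: vector_space "\<lambda>q (x::'a). of_rat q * x" by (rule vector_space_of_rat)
  obtain C where C: "finite C" "\<And>i j. x ^ i * y ^ j \<in> Q.span C"
    using algebraic_common_finite_span[OF assms] by blast
  show ?thesis
    by (rule algebraic_if_finite_span[OF C(1)]) (simp add: power_mult_distrib C(2))
qed

lemma algebraic_power:
  fixes x :: "'a::field_char_0"
  shows "algebraic x \<Longrightarrow> algebraic (x ^ k)"
  by (induction k) (auto intro: algebraic_mult)

lemma algebraic_sum:
  fixes f :: "'b \<Rightarrow> 'a::field_char_0"
  shows "(\<And>i. i \<in> I \<Longrightarrow> algebraic (f i)) \<Longrightarrow> algebraic (sum f I)"
  by (induction I rule: infinite_finite_induct) (auto intro: algebraic_add)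

text \<open>The conjugate of an algebraic number is algebraic, and both parts are combinations of
  \<open>z\<close> and \<open>cnj z\<close> with algebraic coefficients.\<close>

lemma algebraic_complex_Re_Im:
  assumes "algebraic z"
  shows "algebraic (Re z)" "algebraic (Im z)"
proof -
  have half: "algebraic (1 / 2 :: complex)" by (rule rat_imp_algebraic) auto
  have "algebraic ((z + cnj z) * (1 / 2))"
    using assms by (intro algebraic_mult algebraic_add half) auto
  also have "(z + cnj z) * (1 / 2) = of_real (Re z)" by (simp add: complex_eq_iff)
  finally show "algebraic (Re z)" by simp
  have "algebraic ((z + - cnj z) * (1 / 2) * - \<i>)"
    using assms by (intro algebraic_mult algebraic_add half) auto
  also have "(z + - cnj z) * (1 / 2) * - \<i> = of_real (Im z)" by (simp add: complex_eq_iff)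
  finally show "algebraic (Im z)" by simp
qed

subsection \<open>Polynomial functions with algebraic coefficients\<close>

text \<open>The definition wants one coefficient per multi-index, whereas here several indices may
  share an exponent vector \<open>e a\<close>; their coefficients are collected in \<open>C\<close>.
  Sums and products of polynomials can thus be indexed by \<open>I <+> J\<close> and
  \<open>I \<times> J\<close>.\<close>

lemma alg_poly_fun_monomial_sum:
  assumes "finite I"
    and c: "\<And>a. a \<in> I \<Longrightarrow> algebraic (c a)"
    and e: "\<And>a i. a \<in> I \<Longrightarrow> i \<ge> n \<Longrightarrow> e a i = 0"
  shows "alg_poly_fun n (\<lambda>x. \<Sum>a\<in>I. c a * (\<Prod>i<n. x i ^ e a i))"
proof -
  define C where "C \<alpha> = (\<Sum>a | a \<in> I \<and> e a = \<alpha>. c a)" for \<alpha>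
  \<comment> \<open>Collected coefficients may cancel, so this is only an inclusion.\<close>
  have sub: "{\<alpha>. C \<alpha> \<noteq> 0} \<subseteq> e ` I"
  proof
    fix \<alpha> assume "\<alpha> \<in> {\<alpha>. C \<alpha> \<noteq> 0}"
    then have "{a. a \<in> I \<and> e a = \<alpha>} \<noteq> {}" unfolding C_def by force
    then show "\<alpha> \<in> e ` I" by auto
  qed
  have "(\<Sum>a\<in>I. c a * (\<Prod>i<n. x i ^ e a i)) = (\<Sum>\<alpha>\<in>{\<alpha>. C \<alpha> \<noteq> 0}. C \<alpha> * (\<Prod>i<n. x i ^ \<alpha> i))"
    for x :: "nat \<Rightarrow> real"
  proof -
    have "(\<Sum>a\<in>I. c a * (\<Prod>i<n. x i ^ e a i))
        = (\<Sum>\<alpha>\<in>e ` I. \<Sum>a | a \<in> I \<and> e a = \<alpha>. c a * (\<Prod>i<n. x i ^ e a i))"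
      by (rule sum.image_gen[OF assms(1)])
    also have "\<dots> = (\<Sum>\<alpha>\<in>e ` I. C \<alpha> * (\<Prod>i<n. x i ^ \<alpha> i))"
      by (simp add: C_def sum_distrib_right)
    also have "\<dots> = (\<Sum>\<alpha>\<in>{\<alpha>. C \<alpha> \<noteq> 0}. C \<alpha> * (\<Prod>i<n. x i ^ \<alpha> i))"
      using sub assms(1) by (intro sum.mono_neutral_right) auto
    finally show ?thesis .
  qed
  moreover have "finite {\<alpha>. C \<alpha> \<noteq> 0}" using sub assms(1) by (auto intro: finite_subset)
  moreover have "algebraic (C \<alpha>)" for \<alpha>
    unfolding C_def by (rule algebraic_sum) (auto intro: c)
  moreover have "\<alpha> i = 0" if "C \<alpha> \<noteq> 0" "i \<ge> n" for \<alpha> i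
    using sub that e by auto
  ultimately show ?thesis unfolding alg_poly_fun_def by (intro exI[of _ C]) simp
qed

lemma alg_poly_funE:
  assumes "alg_poly_fun n P"
  obtains I c where "finite I" "\<And>\<alpha>. \<alpha> \<in> I \<Longrightarrow> algebraic (c \<alpha>)"
    "\<And>\<alpha> i. \<alpha> \<in> I \<Longrightarrow> i \<ge> n \<Longrightarrow> \<alpha> i = 0"
    "P = (\<lambda>x. \<Sum>\<alpha>\<in>I. c \<alpha> * (\<Prod>i<n. x i ^ \<alpha> i))"
proof -
  obtain c where c: "finite {\<alpha>. c \<alpha> \<noteq> 0}"
    "\<And>\<alpha>. c \<alpha> \<noteq> 0 \<Longrightarrow> algebraic (c \<alpha>) \<and> (\<forall>i\<ge>n. \<alpha> i = 0)"
    "\<And>x. P x = (\<Sum>\<alpha>\<in>{\<alpha>. c \<alpha> \<noteq> 0}. c \<alpha> * (\<Prod>i<n. x i ^ \<alpha> i))"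
    using assms unfolding alg_poly_fun_def by blast
  show ?thesis by (rule that[of "{\<alpha>. c \<alpha> \<noteq> 0}" c]) (use c in auto)
qed

lemma alg_poly_fun_const:
  assumes "algebraic c"
  shows "alg_poly_fun n (\<lambda>x. c)"
  using alg_poly_fun_monomial_sum[of "{()}" "\<lambda>_. c" n "\<lambda>_ _. 0"] assms by simp

lemma alg_poly_fun_coord:
  assumes "i < n"
  shows "alg_poly_fun n (\<lambda>x. x i)"
proof -
  have "alg_poly_fun n (\<lambda>x. \<Sum>a\<in>{()}. 1 * (\<Prod>j<n. x j ^ of_bool (j = i)))"
    by (rule alg_poly_fun_monomial_sum) (use assms in auto)
  moreover have "(\<Prod>j<n. x j ^ of_bool (j = i)) = x i" for x :: "nat \<Rightarrow> real"
  proof -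
    have "(\<Prod>j<n. x j ^ of_bool (j = i)) = (\<Prod>j<n. if j = i then x j else 1)"
      by (intro prod.cong) auto
    then show ?thesis using assms by simp
  qed
  ultimately show ?thesis by simp
qed

lemma alg_poly_fun_add:
  assumes "alg_poly_fun n P" "alg_poly_fun n Q"
  shows "alg_poly_fun n (\<lambda>x. P x + Q x)"
proof -
  obtain I c where P: "finite I" "\<And>\<alpha>. \<alpha> \<in> I \<Longrightarrow> algebraic (c \<alpha>)"
    "\<And>\<alpha> i. \<alpha> \<in> I \<Longrightarrow> i \<ge> n \<Longrightarrow> \<alpha> i = 0"
    "P = (\<lambda>x. \<Sum>\<alpha>\<in>I. c \<alpha> * (\<Prod>i<n. x i ^ \<alpha> i))"
    using alg_poly_funE[OF assms(1)] by blast
  obtain J d where Q: "finite J" "\<And>\<alpha>. \<alpha> \<in> J \<Longrightarrow> algebraic (d \<alpha>)"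
    "\<And>\<alpha> i. \<alpha> \<in> J \<Longrightarrow> i \<ge> n \<Longrightarrow> \<alpha> i = 0"
    "Q = (\<lambda>x. \<Sum>\<alpha>\<in>J. d \<alpha> * (\<Prod>i<n. x i ^ \<alpha> i))"
    using alg_poly_funE[OF assms(2)] by blast
  have "alg_poly_fun n (\<lambda>x. \<Sum>a\<in>I <+> J. case_sum c d a * (\<Prod>i<n. x i ^ case_sum id id a i))"
    by (rule alg_poly_fun_monomial_sum) (use P Q in auto)
  then show ?thesis using P(1) Q(1) by (simp add: P(4) Q(4) sum.Plus)
qed

lemma alg_poly_fun_mult:
  assumes "alg_poly_fun n P" "alg_poly_fun n Q"
  shows "alg_poly_fun n (\<lambda>x. P x * Q x)"
proof -
  obtain I c where P: "finite I" "\<And>\<alpha>. \<alpha> \<in> I \<Longrightarrow> algebraic (c \<alpha>)"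
    "\<And>\<alpha> i. \<alpha> \<in> I \<Longrightarrow> i \<ge> n \<Longrightarrow> \<alpha> i = 0"
    "P = (\<lambda>x. \<Sum>\<alpha>\<in>I. c \<alpha> * (\<Prod>i<n. x i ^ \<alpha> i))"
    using alg_poly_funE[OF assms(1)] by blast
  obtain J d where Q: "finite J" "\<And>\<alpha>. \<alpha> \<in> J \<Longrightarrow> algebraic (d \<alpha>)"
    "\<And>\<alpha> i. \<alpha> \<in> J \<Longrightarrow> i \<ge> n \<Longrightarrow> \<alpha> i = 0"
    "Q = (\<lambda>x. \<Sum>\<alpha>\<in>J. d \<alpha> * (\<Prod>i<n. x i ^ \<alpha> i))"
    using alg_poly_funE[OF assms(2)] by blast
  have "alg_poly_fun n (\<lambda>x. \<Sum>a\<in>I \<times> J. (c (fst a) * d (snd a)) * (\<Prod>i<n. x i ^ (fst a i + snd a i)))"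
    by (rule alg_poly_fun_monomial_sum) (use P Q in \<open>auto intro: algebraic_mult\<close>)
  moreover have "P x * Q x
      = (\<Sum>a\<in>I \<times> J. (c (fst a) * d (snd a)) * (\<Prod>i<n. x i ^ (fst a i + snd a i)))" for x
    unfolding P(4) Q(4) sum_product sum.cartesian_product
    by (intro sum.cong) (auto simp: power_add prod.distrib algebra_simps)
  ultimately show ?thesis by simp
qed

lemma alg_poly_fun_uminus:
  assumes "alg_poly_fun n P"
  shows "alg_poly_fun n (\<lambda>x. - P x)"
  using alg_poly_fun_mult[OF alg_poly_fun_const[of "-1"] assms] by simp

lemma alg_poly_fun_diff:
  assumes "alg_poly_fun n P" "alg_poly_fun n Q"
  shows "alg_poly_fun n (\<lambda>x. P x - Q x)"
  using alg_poly_fun_add[OF assms(1) alg_poly_fun_uminus[OF assms(2)]] by simp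

lemma alg_poly_fun_power:
  assumes "alg_poly_fun n P"
  shows "alg_poly_fun n (\<lambda>x. P x ^ k)"
proof (induction k)
  case (Suc k)
  from alg_poly_fun_mult[OF assms Suc] show ?case by simp
qed (simp add: alg_poly_fun_const)

text \<open>Algebraic constants and coordinates generate all these functions under addition and
  multiplication. Later arguments use this induction in place of coefficient manipulations.\<close>

lemma alg_poly_fun_induct [consumes 1, case_names const coord add mult]:
  assumes "alg_poly_fun n P"
    and const: "\<And>c. algebraic c \<Longrightarrow> R (\<lambda>x. c)"
    and coord: "\<And>i. i < n \<Longrightarrow> R (\<lambda>x. x i)"
    and add: "\<And>P Q. R P \<Longrightarrow> R Q \<Longrightarrow> R (\<lambda>x. P x + Q x)"
    and mult: "\<And>P Q. R P \<Longrightarrow> R Q \<Longrightarrow> R (\<lambda>x. P x * Q x)"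
  shows "R P"
proof -
  obtain I c where P: "finite I" "\<And>\<alpha>. \<alpha> \<in> I \<Longrightarrow> algebraic (c \<alpha>)"
    "\<And>\<alpha> i. \<alpha> \<in> I \<Longrightarrow> i \<ge> n \<Longrightarrow> \<alpha> i = 0"
    "P = (\<lambda>x. \<Sum>\<alpha>\<in>I. c \<alpha> * (\<Prod>i<n. x i ^ \<alpha> i))"
    using alg_poly_funE[OF assms(1)] by blast
  have pow: "R (\<lambda>x. x i ^ k)" if "i < n" for i k
  proof (induction k)
    case (Suc k)
    from mult[OF coord[OF that] Suc] show ?case by simp
  qed (simp add: const)
  have prod: "R (\<lambda>x. \<Prod>i<m. x i ^ \<alpha> i)" if "m \<le> n" for \<alpha> :: "nat \<Rightarrow> nat" and m
    using that
  proof (induction m)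
    case (Suc m)
    then have "R (\<lambda>x. \<Prod>i<m. x i ^ \<alpha> i)" "m < n" by simp_all
    from mult[OF this(1) pow[OF this(2)]] show ?case by simp
  qed (simp add: const)
  \<comment> \<open>Quantifying over subsets of \<open>I\<close> lets the induction on the index set
    keep the algebraicity of the coefficients.\<close>
  have "R (\<lambda>x. \<Sum>\<alpha>\<in>J. c \<alpha> * (\<Prod>i<n. x i ^ \<alpha> i))" if "J \<subseteq> I" for J
    using finite_subset[OF that P(1)] that
  proof (induction J rule: finite_induct)
    case (insert a J)
    then have "R (\<lambda>x. \<Sum>\<alpha>\<in>J. c \<alpha> * (\<Prod>i<n. x i ^ \<alpha> i))" "algebraic (c a)"
      using P(2) by auto
    from add[OF mult[OF const[OF this(2)] prod[OF order_refl]] this(1)] insert(1,2)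
    show ?case by simp
  qed (simp add: const)
  then show ?thesis using P(4) by simp
qed

lemma alg_poly_fun_compose:
  assumes "alg_poly_fun n P" and "\<And>i. i < n \<Longrightarrow> alg_poly_fun m (\<lambda>x. f x i)"
  shows "alg_poly_fun m (\<lambda>x. P (f x))"
  using assms(1)
  by (induction rule: alg_poly_fun_induct)
    (auto intro: alg_poly_fun_const alg_poly_fun_add alg_poly_fun_mult assms(2))

lemma alg_poly_fun_measurable [measurable (raw)]:
  assumes "alg_poly_fun n P"
  shows "P \<in> borel_measurable (lebesgue_n n)"
  using assms unfolding lebesgue_n_def
proof (induction rule: alg_poly_fun_induct)
  case (coord i)
  then have "(\<lambda>x. x i) \<in> measurable (PiM {..<n} (\<lambda>_. lborel)) (lborel :: real measure)"
    by (intro measurable_component_singleton) simp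
  then show ?case by simp
qed auto

text \<open>Passing to univariate polynomials makes finiteness of roots and the intermediate value
  theorem available in dimension one.\<close>

lemma alg_poly_fun_1_poly:
  assumes "alg_poly_fun 1 P"
  obtains q where "\<And>x. P x = poly q (x 0)"
proof -
  have "\<exists>q. \<forall>x. P x = poly q (x 0)"
    using assms
  proof (induction rule: alg_poly_fun_induct)
    case (const c)
    then show ?case by (intro exI[of _ "[:c:]"]) simp
  next
    case (coord i)
    then show ?case by (intro exI[of _ "[:0, 1:]"]) simp
  next
    case (add P Q)
    then show ?case by (metis poly_add)
  next
    case (mult P Q)
    then show ?case by (metis poly_mult)
  qed
  then show ?thesis using that by blast
qed

subsection \<open>Volume-preserving maps\<close>

text \<open>The map \<open>x \<mapsto> - 1 / x\<close> has derivative \<open>1 / x\<^sup>2\<close>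
  and is increasing on each half-line. Substitution is done on compact intervals away from the pole,
  followed by monotone convergence.\<close>

lemma nn_integral_lborel_neg_inverse:
  fixes f :: "real \<Rightarrow> ennreal"
  assumes [measurable]: "f \<in> borel_measurable borel"
  shows "(\<integral>\<^sup>+x. f (- 1 / x) * ennreal (1 / x\<^sup>2) \<partial>lborel) = (\<integral>\<^sup>+x. f x \<partial>lborel)"
proof -
  \<comment> \<open>The offset 2 gives \<open>N k > 1\<close>, so that the intervals from
    \<open>1 / N k\<close> to \<open>N k\<close> are proper.\<close>
  define N where "N k = real k + 2" for k :: nat
  have N: "N k > 1" for k by (simp add: N_def)
  have N1: "1 / N k < N k" for k using N[of k] by (simp add: field_simps less_1_mult)
  define h where "h x = f (- 1 / x) * ennreal (1 / x\<^sup>2)" for x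
  define U where "U k = {- N k..- (1 / N k)} \<union> {1 / N k..N k}" for k
  have [measurable]: "U k \<in> sets borel" for k by (simp add: U_def)
  have [measurable]: "h \<in> borel_measurable borel" unfolding h_def by measurable
  have der: "((\<lambda>x. - 1 / x) has_real_derivative 1 / x\<^sup>2) (at x)" if "x \<noteq> 0" for x :: real
    using that by (auto intro!: derivative_eq_intros simp: power2_eq_square)
  have split: "(\<integral>\<^sup>+x. F x * indicator (U k) x \<partial>lborel)
      = (\<integral>\<^sup>+x. F x * indicator {- N k..- (1 / N k)} x \<partial>lborel)
      + (\<integral>\<^sup>+x. F x * indicator {1 / N k..N k} x \<partial>lborel)"
    if [measurable]: "F \<in> borel_measurable borel" for F :: "real \<Rightarrow> ennreal" and k
  proof -
    have "0 < 1 / N k" using N[of k] by simp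
    then have disj: "x \<le> - (1 / N k) \<Longrightarrow> \<not> 1 / N k \<le> x" for x by linarith
    have "F x * indicator (U k) x
        = F x * indicator {- N k..- (1 / N k)} x + F x * indicator {1 / N k..N k} x" for x
      using disj[of x] by (auto simp: U_def indicator_def simp del: minus_divide_left)
    then show ?thesis by (simp add: nn_integral_add)
  qed
  \<comment> \<open>The map exchanges the two intervals of \<open>U k\<close>, so the truncated
    integrals already agree. The endpoints are first written as images under the map, the form in
    which the substitution rule produces them.\<close>
  have eq: "(\<integral>\<^sup>+x. f x * indicator (U k) x \<partial>lborel) = (\<integral>\<^sup>+x. h x * indicator (U k) x \<partial>lborel)" for k
  proof -
    have "(\<integral>\<^sup>+x. f x * indicator {(- 1) / (1 / N k)..(- 1) / N k} x \<partial>lborel)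
        = (\<integral>\<^sup>+x. f (- 1 / x) * ennreal (1 / x\<^sup>2) * indicator {1 / N k..N k} x \<partial>lborel)"
    proof (rule nn_integral_substitution_aux)
      show "((\<lambda>x. - 1 / x) has_real_derivative 1 / x\<^sup>2) (at x)" if "x \<in> {1 / N k..N k}" for x
        using that N[of k] by (intro der) auto
      show "continuous_on {1 / N k..N k} (\<lambda>x. 1 / x\<^sup>2)"
        using N[of k] by (intro continuous_intros) auto
    qed (use N1 in auto)
    moreover have "(\<integral>\<^sup>+x. f x * indicator {(- 1) / - N k..(- 1) / - (1 / N k)} x \<partial>lborel)
        = (\<integral>\<^sup>+x. f (- 1 / x) * ennreal (1 / x\<^sup>2) * indicator {- N k..- (1 / N k)} x \<partial>lborel)"
    proof (rule nn_integral_substitution_aux)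
      show "((\<lambda>x. - 1 / x) has_real_derivative 1 / x\<^sup>2) (at x)" if "x \<in> {- N k..- (1 / N k)}" for x
      proof (rule der)
        have "0 < 1 / N k" using N[of k] by simp
        then show "x \<noteq> 0" using that by auto
      qed
      show "continuous_on {- N k..- (1 / N k)} (\<lambda>x. 1 / x\<^sup>2)"
      proof -
        have "0 < 1 / N k" using N[of k] by simp
        then show ?thesis by (intro continuous_intros) auto
      qed
    qed (use N1 in auto)
    ultimately show ?thesis
      by (simp add: split h_def add.commute)
  qed
  have sup: "(\<integral>\<^sup>+x. F x \<partial>lborel) = (SUP k. \<integral>\<^sup>+x. F x * indicator (U k) x \<partial>lborel)"
    if [measurable]: "F \<in> borel_measurable borel" for F :: "real \<Rightarrow> ennreal"
  proof -
    have "(\<integral>\<^sup>+x. F x \<partial>lborel) = (\<integral>\<^sup>+x. (SUP k. F x * indicator (U k) x) \<partial>lborel)"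
    proof (rule nn_integral_cong_AE)
      \<comment> \<open>The sets \<open>U k\<close> exhaust everything but the null set consisting
        of 0.\<close>
      show "AE x in lborel. F x = (SUP k. F x * indicator (U k) x)"
        using AE_lborel_singleton[of 0]
      proof eventually_elim
        case (elim x)
        obtain k where k: "\<bar>x\<bar> + 1 / \<bar>x\<bar> \<le> real k" using real_arch_simple by blast
        then have *: "\<bar>x\<bar> \<le> N k" "1 / \<bar>x\<bar> \<le> N k"
          using elim by (auto simp: N_def intro: order_trans[of _ "real k"] elim!: order_trans[rotated])
        have "1 / N k \<le> \<bar>x\<bar>" using *(2) elim N[of k] by (simp add: field_simps)
        with * have "x \<in> U k" by (auto simp: U_def)
        then have "F x \<le> (SUP k. F x * indicator (U k) x)"
          by (intro SUP_upper2[of k]) auto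
        moreover have "(SUP k. F x * indicator (U k) x) \<le> F x"
          by (intro SUP_least) (auto simp: indicator_def)
        ultimately show ?case by (rule antisym)
      qed
    qed
    also have "\<dots> = (SUP k. \<integral>\<^sup>+x. F x * indicator (U k) x \<partial>lborel)"
    proof (rule nn_integral_monotone_convergence_SUP)
      have "U k \<subseteq> U l" if "k \<le> l" for k l
      proof -
        have "N k \<le> N l" using that by (simp add: N_def)
        moreover from this have "1 / N l \<le> 1 / N k" using N[of k] by (simp add: field_simps)
        ultimately show ?thesis by (auto simp: U_def)
      qed
      then show "incseq (\<lambda>k x. F x * indicator (U k) x)"
        by (auto simp: incseq_def le_fun_def indicator_def)
    qed simp
    finally show ?thesis .
  qed
  have "(\<integral>\<^sup>+x. h x \<partial>lborel) = (\<integral>\<^sup>+x. f x \<partial>lborel)"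
    by (simp add: sup eq)
  then show ?thesis by (simp add: h_def)
qed

interpretation lborel_product: product_sigma_finite "\<lambda>_::nat. lborel :: real measure"
  by standard

section \<open>Boxes and concatenation of coordinates\<close>

lemma space_lebesgue_n: "space (lebesgue_n n) = PiE {..<n} (\<lambda>_. UNIV)"
  by (simp add: lebesgue_n_def space_PiM)

lemma measurable_lebesgue_n_component [measurable (raw)]:
  assumes "i < n"
  shows "(\<lambda>x. x i) \<in> borel_measurable (lebesgue_n n)"
  by (rule alg_poly_fun_measurable[OF alg_poly_fun_coord[OF assms]])

lemma emeasure_lebesgue_n_box:
  assumes "\<And>i. i < n \<Longrightarrow> A i \<in> sets borel"
  shows "emeasure (lebesgue_n n) (PiE {..<n} A) = (\<Prod>i<n. emeasure lborel (A i))"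
  unfolding lebesgue_n_def using assms by (intro lborel_product.emeasure_PiM) auto

text \<open>Product measure is determined by its values on boxes. Every map below is shown to
  preserve volume by computing the measure of preimages of boxes.\<close>

lemma lebesgue_n_eqI:
  assumes "sets M = sets (lebesgue_n n)"
    and "\<And>A. (\<And>i. i < n \<Longrightarrow> A i \<in> sets borel)
      \<Longrightarrow> emeasure M (PiE {..<n} A) = (\<Prod>i<n. emeasure lborel (A i))"
  shows "M = lebesgue_n n"
  unfolding lebesgue_n_def
  by (rule lborel_product.PiM_eqI) (use assms in \<open>auto simp: lebesgue_n_def\<close>)

lemma box_lebesgue_n [measurable]:
  assumes "\<And>i. i < n \<Longrightarrow> A i \<in> sets borel"
  shows "PiE {..<n} A \<in> sets (lebesgue_n n)"
  unfolding lebesgue_n_def using assms by (intro sets_PiM_I_finite) auto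

lemma measurable_into_lebesgue_n:
  assumes "\<And>x. x \<in> space M \<Longrightarrow> f x \<in> PiE {..<n} (\<lambda>_. UNIV)"
    and "\<And>i. i < n \<Longrightarrow> (\<lambda>x. f x i) \<in> borel_measurable M"
  shows "f \<in> measurable M (lebesgue_n n)"
proof -
  have "f \<in> measurable M (PiM {..<n} (\<lambda>_. lborel))"
  proof (rule measurable_PiM_single')
    show "f \<in> space M \<rightarrow> (\<Pi>\<^sub>E i\<in>{..<n}. space lborel)" using assms(1) by simp
  qed (use assms(2) in simp)
  then show ?thesis by (simp add: lebesgue_n_def)
qed

text \<open>This identifies the product of \<open>n\<close>-space and \<open>m\<close>-space with
  \<open>(n + m)\<close>-space; the outer restriction keeps the result extensional.\<close>

definition append_coords :: "nat \<Rightarrow> nat \<Rightarrow> (nat \<Rightarrow> real) \<times> (nat \<Rightarrow> real) \<Rightarrow> nat \<Rightarrow> real" where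
  "append_coords n m = (\<lambda>(x, y). \<lambda>i\<in>{..<n + m}. if i < n then x i else y (i - n))"

lemma append_coords_measurable [measurable]:
  "append_coords n m \<in> measurable (lebesgue_n n \<Otimes>\<^sub>M lebesgue_n m) (lebesgue_n (n + m))"
proof (rule measurable_into_lebesgue_n)
  fix i assume i: "i < n + m"
  show "(\<lambda>x. append_coords n m x i) \<in> borel_measurable (lebesgue_n n \<Otimes>\<^sub>M lebesgue_n m)"
  proof (cases "i < n")
    case True
    from measurable_compose[OF measurable_fst measurable_lebesgue_n_component[OF this]]
    show ?thesis using i True by (simp add: append_coords_def case_prod_beta)
  next
    case False
    then have "i - n < m" using i by simp
    from measurable_compose[OF measurable_snd measurable_lebesgue_n_component[OF this]]
    show ?thesis using i False by (simp add: append_coords_def case_prod_beta)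
  qed
qed (simp add: append_coords_def case_prod_beta PiE_iff)

text \<open>The preimage of a box is the product of the box of its first \<open>n\<close> sides and
  the box of its last \<open>m\<close> sides.\<close>

lemma distr_append_coords:
  "distr (lebesgue_n n \<Otimes>\<^sub>M lebesgue_n m) (lebesgue_n (n + m)) (append_coords n m) = lebesgue_n (n + m)"
proof (rule lebesgue_n_eqI)
  fix A :: "nat \<Rightarrow> real set" assume A: "\<And>i. i < n + m \<Longrightarrow> A i \<in> sets borel"
  interpret m: sigma_finite_measure "lebesgue_n m"
    unfolding lebesgue_n_def by (rule lborel_product.sigma_finite) simp
  have box1 [measurable]: "PiE {..<n} A \<in> sets (lebesgue_n n)"
    and box2 [measurable]: "PiE {..<m} (\<lambda>j. A (n + j)) \<in> sets (lebesgue_n m)"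
    using A by (auto intro!: box_lebesgue_n)
  have "append_coords n m -` PiE {..<n + m} A \<inter> space (lebesgue_n n \<Otimes>\<^sub>M lebesgue_n m)
      = PiE {..<n} A \<times> PiE {..<m} (\<lambda>j. A (n + j))" (is "?L = ?R")
  proof (intro equalityI subsetI)
    fix z assume "z \<in> ?L"
    then obtain x y where z: "z = (x, y)" "x \<in> PiE {..<n} (\<lambda>_. UNIV)" "y \<in> PiE {..<m} (\<lambda>_. UNIV)"
      and *: "\<And>i. i < n + m \<Longrightarrow> append_coords n m (x, y) i \<in> A i"
      by (auto simp: space_pair_measure space_lebesgue_n)
    have "x i \<in> A i" if "i < n" for i using *[of i] that by (simp add: append_coords_def)
    moreover have "y j \<in> A (n + j)" if "j < m" for j
      using *[of "n + j"] that by (simp add: append_coords_def)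
    ultimately show "z \<in> ?R" using z by (auto simp: PiE_iff)
  next
    fix z assume "z \<in> ?R"
    then obtain x y where z: "z = (x, y)" "x \<in> PiE {..<n} A" "y \<in> PiE {..<m} (\<lambda>j. A (n + j))"
      by auto
    have "append_coords n m (x, y) i \<in> A i" if "i < n + m" for i
    proof (cases "i < n")
      case False
      then have "y (i - n) \<in> A (n + (i - n))" using z(3) that by (intro PiE_mem[OF z(3)]) auto
      then show ?thesis using False that by (simp add: append_coords_def)
    qed (use z that in \<open>auto simp: append_coords_def\<close>)
    moreover have "append_coords n m (x, y) \<in> extensional {..<n + m}" by (simp add: append_coords_def)
    ultimately show "z \<in> ?L"
      using z by (auto simp: space_pair_measure space_lebesgue_n PiE_iff)
  qed
  moreover have "PiE {..<n + m} A \<in> sets (lebesgue_n (n + m))"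
    using A by (rule box_lebesgue_n)
  ultimately have "emeasure (distr (lebesgue_n n \<Otimes>\<^sub>M lebesgue_n m) (lebesgue_n (n + m)) (append_coords n m)) (PiE {..<n + m} A)
      = emeasure (lebesgue_n n) (PiE {..<n} A) * emeasure (lebesgue_n m) (PiE {..<m} (\<lambda>j. A (n + j)))"
    by (simp add: emeasure_distr m.emeasure_pair_measure_Times)
  also have "\<dots> = (\<Prod>i<n. emeasure lborel (A i)) * (\<Prod>j<m. emeasure lborel (A (n + j)))"
    using A by (simp add: emeasure_lebesgue_n_box)
  also have "(\<Prod>j<m. emeasure lborel (A (n + j))) = (\<Prod>i\<in>{n..<n + m}. emeasure lborel (A i))"
    by (rule prod.reindex_bij_witness[of _ "\<lambda>i. i - n" "\<lambda>j. n + j"]) auto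
  also have "(\<Prod>i<n. emeasure lborel (A i)) * \<dots> = (\<Prod>i<n + m. emeasure lborel (A i))"
    by (subst prod.union_disjoint[symmetric]) (auto intro!: prod.cong)
  finally show "emeasure (distr (lebesgue_n n \<Otimes>\<^sub>M lebesgue_n m) (lebesgue_n (n + m)) (append_coords n m)) (PiE {..<n + m} A)
      = (\<Prod>i<n + m. emeasure lborel (A i))" .
qed simp

section \<open>Translation and inversion of the coordinate \<open>x 0\<close>\<close>

lemma fun_upd_extensional_iff:
  assumes "i \<in> I"
  shows "x(i := v) \<in> extensional I \<longleftrightarrow> x \<in> extensional I"
  using assms by (force simp: extensional_def)

lemma translate_coord_0_measurable [measurable]:
  assumes "n > 0"
  shows "(\<lambda>x. x(0 := x 0 + c)) \<in> measurable (lebesgue_n n) (lebesgue_n n)"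
proof (rule measurable_into_lebesgue_n)
  fix i assume "i < n"
  then show "(\<lambda>x. (x(0 := x 0 + c)) i) \<in> borel_measurable (lebesgue_n n)"
    by (cases "i = 0") auto
qed (use assms in \<open>auto simp: space_lebesgue_n PiE_iff fun_upd_extensional_iff\<close>)

text \<open>The preimage of a box is a box with only side 0 changed, and that side is translated,
  which keeps its length.\<close>

lemma distr_translate_coord_0:
  assumes "n > 0"
  shows "distr (lebesgue_n n) (lebesgue_n n) (\<lambda>x. x(0 := x 0 + c)) = lebesgue_n n"
proof (rule lebesgue_n_eqI)
  fix A :: "nat \<Rightarrow> real set" assume A: "\<And>i. i < n \<Longrightarrow> A i \<in> sets borel"
  define A' where "A' = A(0 := (\<lambda>t. c + t) -` A 0)"
  have 0: "(\<lambda>t. c + t) -` A 0 \<in> sets borel"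
    using measurable_sets[of "\<lambda>t. c + t" borel borel "A 0"] A assms by simp
  then have A': "A' i \<in> sets borel" if "i < n" for i using A that by (simp add: A'_def)
  have "emeasure lborel (A 0) = emeasure (distr lborel borel ((+) c)) (A 0)"
    by (simp add: lborel_distr_plus)
  also have "\<dots> = emeasure lborel ((\<lambda>t. c + t) -` A 0)"
    using A assms by (subst emeasure_distr) auto
  finally have e: "emeasure lborel (A' i) = emeasure lborel (A i)" for i
    by (simp add: A'_def)
  have "(\<lambda>x. x(0 := x 0 + c)) -` PiE {..<n} A \<inter> space (lebesgue_n n) = PiE {..<n} A'"
  proof (rule set_eqI)
    fix x
    have "x \<in> (\<lambda>x. x(0 := x 0 + c)) -` PiE {..<n} A \<inter> space (lebesgue_n n)
        \<longleftrightarrow> x \<in> extensional {..<n} \<and> (\<forall>i<n. (x(0 := x 0 + c)) i \<in> A i)"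
      using fun_upd_extensional_iff[of 0 "{..<n}" x] assms
      by (auto simp: space_lebesgue_n PiE_iff simp del: fun_upd_apply)
    also have "(\<forall>i<n. (x(0 := x 0 + c)) i \<in> A i) \<longleftrightarrow> (\<forall>i<n. x i \<in> A' i)"
      by (simp add: A'_def add.commute)
    finally show "x \<in> (\<lambda>x. x(0 := x 0 + c)) -` PiE {..<n} A \<inter> space (lebesgue_n n) \<longleftrightarrow> x \<in> PiE {..<n} A'"
      by (simp only: PiE_iff Ball_def lessThan_iff conj_commute)
  qed
  then show "emeasure (distr (lebesgue_n n) (lebesgue_n n) (\<lambda>x. x(0 := x 0 + c))) (PiE {..<n} A)
      = (\<Prod>i<n. emeasure lborel (A i))"
    using A A' assms by (simp add: emeasure_distr box_lebesgue_n emeasure_lebesgue_n_box e)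
qed simp

text \<open>The stretching of \<open>x 1\<close> by \<open>(x 0)\<^sup>2\<close> compensates the
  derivative \<open>1 / (x 0)\<^sup>2\<close> of the first component. Since division by 0 yields 0,
  points with \<open>x 0 = 0\<close> are sent to points whose coordinate 0 is 0.\<close>

definition invert_coord :: "(nat \<Rightarrow> real) \<Rightarrow> nat \<Rightarrow> real" where
  "invert_coord x = x(0 := - 1 / x 0, 1 := (x 0)\<^sup>2 * x 1)"

lemma invert_coord_measurable [measurable]:
  assumes "n \<ge> 2"
  shows "invert_coord \<in> measurable (lebesgue_n n) (lebesgue_n n)"
proof (rule measurable_into_lebesgue_n)
  fix i assume i: "i < n"
  have [measurable]: "(\<lambda>x. x 0) \<in> borel_measurable (lebesgue_n n)"
    "(\<lambda>x. x (Suc 0)) \<in> borel_measurable (lebesgue_n n)"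
    using assms by auto
  consider "i = 0" | "i = 1" | "i > 1" by linarith
  then show "(\<lambda>x. invert_coord x i) \<in> borel_measurable (lebesgue_n n)"
    by cases (use i in \<open>simp_all add: invert_coord_def\<close>)
qed (use assms in \<open>simp add: space_lebesgue_n PiE_iff fun_upd_extensional_iff invert_coord_def\<close>)

lemma emeasure_lborel_scale_vimage:
  fixes c :: real
  assumes "c \<noteq> 0" and [measurable]: "A \<in> sets borel"
  shows "emeasure lborel ((\<lambda>y. c * y) -` A) = ennreal (1 / \<bar>c\<bar>) * emeasure lborel A"
proof -
  have "emeasure lborel ((\<lambda>y. c * y) -` A) = emeasure (distr lborel borel ((*) c)) A"
    by (subst emeasure_distr) auto
  also have "\<dots> = ennreal (1 / \<bar>c\<bar>) * emeasure lborel A"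
    using assms by (simp add: lborel_distr_mult emeasure_density nn_integral_cmult_indicator inverse_eq_divide)
  finally show ?thesis .
qed

text \<open>By Tonelli with coordinate 0 outermost: the slice of the preimage of a box at
  \<open>x 0 = y\<close> is empty or a box, one of whose sides is scaled by
  \<open>1 / y\<^sup>2\<close>. The substitution \<open>y \<mapsto> - 1 / y\<close> absorbs this
  factor.\<close>

lemma distr_invert_coord:
  assumes "n \<ge> 2"
  shows "distr (lebesgue_n n) (lebesgue_n n) invert_coord = lebesgue_n n"
proof (rule lebesgue_n_eqI)
  fix A :: "nat \<Rightarrow> real set" assume A: "\<And>i. i < n \<Longrightarrow> A i \<in> sets borel"
  define I where "I = {1..<n}"
  have I: "insert 0 I = {..<n}" "finite I" "0 \<notin> I" "insert 1 {2..<n} = I"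
    using assms by (auto simp: I_def)
  define V where "V = invert_coord -` PiE {..<n} A \<inter> space (lebesgue_n n)"
  have meas: "V \<in> sets (lebesgue_n n)"
    unfolding V_def by (rule measurable_sets[OF invert_coord_measurable[OF assms] box_lebesgue_n[OF A]])
  \<comment> \<open>\<open>c\<close> is the contribution of all sides other than side 0.\<close>
  define c where "c = (\<Prod>i\<in>I. emeasure lborel (A i))"
  have [measurable]: "A 0 \<in> sets borel" using A assms by auto
  have "emeasure (lebesgue_n n) V = (\<integral>\<^sup>+x. indicator V x \<partial>lebesgue_n n)"
    using meas by simp
  also have "\<dots> = (\<integral>\<^sup>+x. indicator V x \<partial>PiM (insert 0 I) (\<lambda>_. lborel))"
    by (simp add: lebesgue_n_def I)
  also have "\<dots> = (\<integral>\<^sup>+y. (\<integral>\<^sup>+x. indicator V (x(0 := y)) \<partial>PiM I (\<lambda>_. lborel)) \<partial>lborel)"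
  proof (rule lborel_product.product_nn_integral_insert_rev)
    show "indicator V \<in> borel_measurable (PiM (insert 0 I) (\<lambda>_. lborel))"
      using meas by (simp add: I lebesgue_n_def)
  qed (use I in auto)
  also have "\<dots> = (\<integral>\<^sup>+y. indicator (A 0) (- 1 / y) * ennreal (1 / y\<^sup>2) * c \<partial>lborel)"
  proof (rule nn_integral_cong_AE)
    show "AE y in lborel. (\<integral>\<^sup>+x. indicator V (x(0 := y)) \<partial>PiM I (\<lambda>_. lborel))
        = indicator (A 0) (- 1 / y) * ennreal (1 / y\<^sup>2) * c"
      using AE_lborel_singleton[of 0]
    proof eventually_elim
      case (elim y)
      \<comment> \<open>\<open>B\<close> gives the sides of the slice at \<open>y\<close>. The value
        \<open>y = 0\<close>, where the scaling degenerates, has been discarded as a null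
        set.\<close>
      define B where "B = A(1 := (\<lambda>t. y\<^sup>2 * t) -` A 1)"
      have B1: "(\<lambda>t. y\<^sup>2 * t) -` A 1 \<in> sets borel"
        using measurable_sets[of "\<lambda>t. y\<^sup>2 * t" borel borel "A 1"] A assms by simp
      then have B: "B i \<in> sets lborel" if "i \<in> I" for i
        using A that by (auto simp: B_def I_def)
      have "indicator V (x(0 := y)) = (indicator (A 0) (- 1 / y) * indicator (PiE I B) x :: ennreal)"
        if "x \<in> space (PiM I (\<lambda>_. lborel))" for x
      proof -
        have "x(0 := y) \<in> V \<longleftrightarrow> - 1 / y \<in> A 0 \<and> x \<in> PiE I B"
        proof -
          have ext: "x \<in> extensional I" using that by (simp add: space_PiM PiE_iff)
          have "x(0 := y) \<in> V \<longleftrightarrow> (\<forall>i<n. invert_coord (x(0 := y)) i \<in> A i)"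
          proof -
            have "x(0 := y) \<in> extensional {..<n}"
              using ext assms by (auto simp: extensional_def I_def)
            moreover have "invert_coord (x(0 := y)) \<in> extensional {..<n}"
              using calculation assms by (simp add: invert_coord_def fun_upd_extensional_iff)
            ultimately show ?thesis
              unfolding V_def by (simp only: vimage_eq Int_iff space_lebesgue_n PiE_iff) auto
          qed
          also have "\<dots> \<longleftrightarrow> (\<forall>i\<in>insert 0 I. invert_coord (x(0 := y)) i \<in> A i)"
            unfolding I(1) by auto
          also have "\<dots> \<longleftrightarrow> - 1 / y \<in> A 0 \<and> (\<forall>i\<in>I. x i \<in> B i)"
            using assms by (auto simp: B_def invert_coord_def I_def)
          finally show ?thesis using ext by (auto simp: PiE_iff)
        qed
        then show ?thesis by (auto simp: indicator_def)
      qed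
      then have "(\<integral>\<^sup>+x. indicator V (x(0 := y)) \<partial>PiM I (\<lambda>_. lborel))
          = (\<integral>\<^sup>+x. indicator (A 0) (- 1 / y) * indicator (PiE I B) x \<partial>PiM I (\<lambda>_. lborel))"
        by (rule nn_integral_cong)
      also have "\<dots> = indicator (A 0) (- 1 / y) * emeasure (PiM I (\<lambda>_. lborel)) (PiE I B)"
        using B I(2) by (intro nn_integral_cmult_indicator sets_PiM_I_finite) auto
      also have "emeasure (PiM I (\<lambda>_. lborel)) (PiE I B) = (\<Prod>i\<in>I. emeasure lborel (B i))"
        using B I(2) by (intro lborel_product.emeasure_PiM) auto
      also have "\<dots> = ennreal (1 / y\<^sup>2) * c"
      proof -
        have "(\<Prod>i\<in>I. emeasure lborel (B i)) = emeasure lborel (B 1) * (\<Prod>i\<in>{2..<n}. emeasure lborel (A i))"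
          unfolding I(4)[symmetric] by (simp add: B_def)
        also have "emeasure lborel (B 1) = ennreal (1 / y\<^sup>2) * emeasure lborel (A 1)"
          using emeasure_lborel_scale_vimage[of "y\<^sup>2" "A 1"] elim A assms by (simp add: B_def)
        finally show ?thesis unfolding c_def I(4)[symmetric] by (simp add: mult.assoc)
      qed
      finally show ?case by (simp only: mult.assoc)
    qed
  qed
  also have "\<dots> = (\<integral>\<^sup>+y. indicator (A 0) (- 1 / y) * ennreal (1 / y\<^sup>2) \<partial>lborel) * c"
    by (rule nn_integral_multc) measurable
  also have "\<dots> = emeasure lborel (A 0) * c"
    by (subst nn_integral_lborel_neg_inverse) auto
  also have "\<dots> = (\<Prod>i<n. emeasure lborel (A i))"
    unfolding I(1)[symmetric] c_def using I(2,3) by simp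
  finally show "emeasure (distr (lebesgue_n n) (lebesgue_n n) invert_coord) (PiE {..<n} A)
      = (\<Prod>i<n. emeasure lborel (A i))"
    using A assms by (simp add: emeasure_distr box_lebesgue_n V_def)
qed simp

subsection \<open>Semialgebraic sets of finite volume\<close>

text \<open>This is the shape part of admissibility, without the volume condition, generated
  inductively so that properties can be proved by rule induction instead of on lists of lists of
  inequalities.\<close>

inductive semialgebraic :: "nat \<Rightarrow> (nat \<Rightarrow> real) set \<Rightarrow> bool" for n where
  empty: "semialgebraic n {}"
| space: "semialgebraic n (PiE {..<n} (\<lambda>_. UNIV))"
| ge: "alg_poly_fun n P \<Longrightarrow> semialgebraic n {x \<in> PiE {..<n} (\<lambda>_. UNIV). P x \<ge> 0}"
| gt: "alg_poly_fun n P \<Longrightarrow> semialgebraic n {x \<in> PiE {..<n} (\<lambda>_. UNIV). P x > 0}"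
| Int: "semialgebraic n S \<Longrightarrow> semialgebraic n T \<Longrightarrow> semialgebraic n (S \<inter> T)"
| Un: "semialgebraic n S \<Longrightarrow> semialgebraic n T \<Longrightarrow> semialgebraic n (S \<union> T)"

lemma semialgebraic_basic_set:
  assumes "\<forall>(P, _) \<in> set L. alg_poly_fun n P"
  shows "semialgebraic n (basic_set n L)"
  using assms
proof (induction L)
  case Nil
  then show ?case by (simp add: basic_set_def semialgebraic.space)
next
  case (Cons a L)
  obtain P s where a: "a = (P, s)" by (cases a)
  have P: "alg_poly_fun n P" and IH: "semialgebraic n (basic_set n L)"
    using Cons by (auto simp: a)
  have "basic_set n (a # L) = basic_set n L \<inter>
      {x \<in> PiE {..<n} (\<lambda>_. UNIV). if s then P x > 0 else P x \<ge> 0}"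
    by (auto simp: basic_set_def a)
  also have "semialgebraic n \<dots>"
    using P IH by (cases s) (auto intro: semialgebraic.intros)
  finally show ?case .
qed

lemma basic_set_append: "basic_set n (L @ M) = basic_set n L \<inter> basic_set n M"
  by (auto simp: basic_set_def)

text \<open>A finite union of finite conjunctions is a disjunctive normal form, and such forms are
  stable under union and, by distributivity, under intersection.\<close>

lemma semialgebraic_iff:
  "semialgebraic n S \<longleftrightarrow> (\<exists>Ls. (\<forall>L \<in> set Ls. \<forall>(P, _) \<in> set L. alg_poly_fun n P) \<and>
     S = (\<Union>L \<in> set Ls. basic_set n L))" (is "_ \<longleftrightarrow> ?R S")
proof
  assume "semialgebraic n S"
  then show "?R S"
  proof induction
    case empty
    show ?case by (intro exI[of _ "[]"]) simp
  next
    case space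
    show ?case by (intro exI[of _ "[[]]"]) (simp add: basic_set_def)
  next
    case (ge P)
    then show ?case by (intro exI[of _ "[[(P, False)]]"]) (simp add: basic_set_def)
  next
    case (gt P)
    then show ?case by (intro exI[of _ "[[(P, True)]]"]) (simp add: basic_set_def)
  next
    case (Int S T)
    then obtain Ls Ms where
      L: "\<forall>L \<in> set Ls. \<forall>(P, _) \<in> set L. alg_poly_fun n P" "S = (\<Union>L \<in> set Ls. basic_set n L)" and
      M: "\<forall>L \<in> set Ms. \<forall>(P, _) \<in> set L. alg_poly_fun n P" "T = (\<Union>L \<in> set Ms. basic_set n L)"
      by metis
    \<comment> \<open>Distributing the intersection leaves one conjunction for each pair of
      disjuncts.\<close>
    define Ks where "Ks = map (\<lambda>(L, M). L @ M) (List.product Ls Ms)"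
    have "S \<inter> T = (\<Union>K \<in> set Ks. basic_set n K)"
      by (auto simp: L(2) M(2) Ks_def basic_set_append)
    moreover have "\<forall>K \<in> set Ks. \<forall>(P, _) \<in> set K. alg_poly_fun n P"
      using L(1) M(1) by (fastforce simp: Ks_def)
    ultimately show ?case by blast
  next
    case (Un S T)
    then obtain Ls Ms where
      L: "\<forall>L \<in> set Ls. \<forall>(P, _) \<in> set L. alg_poly_fun n P" "S = (\<Union>L \<in> set Ls. basic_set n L)" and
      M: "\<forall>L \<in> set Ms. \<forall>(P, _) \<in> set L. alg_poly_fun n P" "T = (\<Union>L \<in> set Ms. basic_set n L)"
      by metis
    show ?case
      by (rule exI[of _ "Ls @ Ms"]) (use L M in auto)
  qed
next
  assume "?R S"
  then obtain Ls where Ls: "\<forall>L \<in> set Ls. \<forall>(P, _) \<in> set L. alg_poly_fun n P"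
    "S = (\<Union>L \<in> set Ls. basic_set n L)" by blast
  have "semialgebraic n (\<Union>L \<in> set Ls. basic_set n L)"
    using Ls(1) by (induction Ls) (auto intro: semialgebraic.intros semialgebraic_basic_set)
  then show "semialgebraic n S" by (simp add: Ls)
qed

lemma admissible_iff:
  "admissible n S \<longleftrightarrow> semialgebraic n S \<and> emeasure (lebesgue_n n) S < \<infinity>"
  by (simp add: admissible_def semialgebraic_iff)

lemma semialgebraic_sets [measurable]:
  assumes "semialgebraic n S"
  shows "S \<in> sets (lebesgue_n n)"
  using assms
proof induction
  case (ge P)
  have "{x \<in> space (lebesgue_n n). P x \<ge> 0} \<in> sets (lebesgue_n n)"
    using alg_poly_fun_measurable[OF ge] by measurable
  then show ?case by (simp add: space_lebesgue_n)
next
  case (gt P)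
  have "{x \<in> space (lebesgue_n n). P x > 0} \<in> sets (lebesgue_n n)"
    using alg_poly_fun_measurable[OF gt] by measurable
  then show ?case by (simp add: space_lebesgue_n)
next
  case space
  show ?case using sets.top[of "lebesgue_n n"] by (simp add: space_lebesgue_n)
qed auto

lemma semialgebraic_subset: "semialgebraic n S \<Longrightarrow> S \<subseteq> PiE {..<n} (\<lambda>_. UNIV)"
  using sets.sets_into_space[OF semialgebraic_sets] by (simp add: space_lebesgue_n)

text \<open>Only the signs of the pulled-back polynomials matter, so denominators may be cleared.\<close>

lemma semialgebraic_pullback:
  assumes "semialgebraic n S" and D: "semialgebraic m D"
    and f: "\<And>x. x \<in> D \<Longrightarrow> f x \<in> PiE {..<n} (\<lambda>_. UNIV)"
    and poly: "\<And>P. alg_poly_fun n P \<Longrightarrow>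
      \<exists>Q. alg_poly_fun m Q \<and> (\<forall>x\<in>D. (Q x > 0 \<longleftrightarrow> P (f x) > 0) \<and> (Q x \<ge> 0 \<longleftrightarrow> P (f x) \<ge> 0))"
  shows "semialgebraic m {x \<in> D. f x \<in> S}"
  using assms(1)
proof induction
  case empty
  show ?case by (simp add: semialgebraic.empty)
next
  case space
  have "{x \<in> D. f x \<in> PiE {..<n} (\<lambda>_. UNIV)} = D" using f by blast
  then show ?case using D by simp
next
  case (ge P)
  obtain Q where Q: "alg_poly_fun m Q" "\<forall>x\<in>D. Q x \<ge> 0 \<longleftrightarrow> P (f x) \<ge> 0"
    using poly[OF ge] by blast
  have "{x \<in> D. f x \<in> {x \<in> PiE {..<n} (\<lambda>_. UNIV). P x \<ge> 0}} = D \<inter> {x \<in> PiE {..<m} (\<lambda>_. UNIV). Q x \<ge> 0}"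
  proof (rule set_eqI)
    fix x
    show "x \<in> {x \<in> D. f x \<in> {x \<in> PiE {..<n} (\<lambda>_. UNIV). P x \<ge> 0}} \<longleftrightarrow> x \<in> D \<inter> {x \<in> PiE {..<m} (\<lambda>_. UNIV). Q x \<ge> 0}"
      using Q(2) f[of x] subsetD[OF semialgebraic_subset[OF D], of x] by (cases "x \<in> D") simp_all
  qed
  then show ?case using Q(1) D by (simp add: semialgebraic.intros)
next
  case (gt P)
  obtain Q where Q: "alg_poly_fun m Q" "\<forall>x\<in>D. Q x > 0 \<longleftrightarrow> P (f x) > 0"
    using poly[OF gt] by blast
  have "{x \<in> D. f x \<in> {x \<in> PiE {..<n} (\<lambda>_. UNIV). P x > 0}} = D \<inter> {x \<in> PiE {..<m} (\<lambda>_. UNIV). Q x > 0}"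
  proof (rule set_eqI)
    fix x
    show "x \<in> {x \<in> D. f x \<in> {x \<in> PiE {..<n} (\<lambda>_. UNIV). P x > 0}} \<longleftrightarrow> x \<in> D \<inter> {x \<in> PiE {..<m} (\<lambda>_. UNIV). Q x > 0}"
      using Q(2) f[of x] subsetD[OF semialgebraic_subset[OF D], of x] by (cases "x \<in> D") simp_all
  qed
  then show ?case using Q(1) D by (simp add: semialgebraic.intros)
next
  case (Int S T)
  have "{x \<in> D. f x \<in> S \<inter> T} = {x \<in> D. f x \<in> S} \<inter> {x \<in> D. f x \<in> T}" by blast
  then show ?case using Int.IH by (simp add: semialgebraic.intros)
next
  case (Un S T)
  have "{x \<in> D. f x \<in> S \<union> T} = {x \<in> D. f x \<in> S} \<union> {x \<in> D. f x \<in> T}" by blast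
  then show ?case using Un.IH by (simp add: semialgebraic.intros)
qed

text \<open>For a polynomial map no denominators occur: the composition of \<open>P\<close> with
  \<open>f\<close> itself serves as the required polynomial.\<close>

lemma semialgebraic_poly_pullback:
  assumes "semialgebraic n S"
    and "\<And>x. x \<in> PiE {..<m} (\<lambda>_. UNIV) \<Longrightarrow> f x \<in> PiE {..<n} (\<lambda>_. UNIV)"
    and "\<And>i. i < n \<Longrightarrow> alg_poly_fun m (\<lambda>x. f x i)"
  shows "semialgebraic m {x \<in> PiE {..<m} (\<lambda>_. UNIV). f x \<in> S}"
  by (rule semialgebraic_pullback[OF assms(1) semialgebraic.space])
    (use assms(2) alg_poly_fun_compose[where f = f, OF _ assms(3)] in \<open>auto intro!: exI\<close>)

lemma admissible_translate:
  assumes "admissible n S" "n > 0"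
  obtains S' where "admissible n S'" "vol_n n S' = vol_n n S"
    "\<And>x. x \<in> S' \<Longrightarrow> x(0 := x 0 - real k) \<in> S"
proof -
  \<comment> \<open>The shift is by a natural number, so the pulled-back polynomials keep algebraic
    coefficients.\<close>
  define f where "f x = x(0 := x 0 + - real k)" for x :: "nat \<Rightarrow> real"
  define S' where "S' = {x \<in> PiE {..<n} (\<lambda>_. UNIV). f x \<in> S}"
  have S: "semialgebraic n S" "emeasure (lebesgue_n n) S < \<infinity>"
    using assms by (auto simp: admissible_iff)
  have "semialgebraic n S'"
    unfolding S'_def
  proof (rule semialgebraic_poly_pullback[OF S(1)])
    fix x :: "nat \<Rightarrow> real" assume "x \<in> PiE {..<n} (\<lambda>_. UNIV)"
    then show "f x \<in> PiE {..<n} (\<lambda>_. UNIV)"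
      using assms(2) by (simp add: f_def PiE_iff fun_upd_extensional_iff)
  next
    fix i assume i: "i < n"
    show "alg_poly_fun n (\<lambda>x. f x i)"
    proof (cases "i = 0")
      case True
      have "alg_poly_fun n (\<lambda>x. x 0 + - real k)"
        using assms(2) by (intro alg_poly_fun_add alg_poly_fun_coord alg_poly_fun_const) auto
      then show ?thesis using True by (simp add: f_def)
    qed (use i in \<open>simp add: f_def alg_poly_fun_coord\<close>)
  qed
  moreover have "emeasure (lebesgue_n n) S = emeasure (lebesgue_n n) S'"
  proof -
    have "emeasure (lebesgue_n n) S = emeasure (distr (lebesgue_n n) (lebesgue_n n) f) S"
      using distr_translate_coord_0[OF assms(2), of "- real k"] by (simp add: f_def[abs_def])
    also have "\<dots> = emeasure (lebesgue_n n) (f -` S \<inter> space (lebesgue_n n))"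
      using translate_coord_0_measurable[OF assms(2), of "- real k"] semialgebraic_sets[OF S(1)]
      by (intro emeasure_distr) (simp_all add: f_def[abs_def])
    also have "f -` S \<inter> space (lebesgue_n n) = S'"
      by (auto simp: S'_def space_lebesgue_n)
    finally show ?thesis .
  qed
  ultimately have "admissible n S'" "vol_n n S' = vol_n n S"
    using S(2) by (simp_all add: admissible_iff vol_n_def measure_def)
  moreover have "x(0 := x 0 - real k) \<in> S" if "x \<in> S'" for x
    using that by (simp add: S'_def f_def)
  ultimately show ?thesis by (rule that)
qed

text \<open>A power of \<open>x 0\<close> clears the poles of \<open>- 1 / x 0\<close>. The exponent
  is kept even so that the multiplier is positive off \<open>x 0 = 0\<close> and signs are
  unaffected.\<close>

lemma alg_poly_fun_invert_coord:
  assumes "alg_poly_fun n P" "n \<ge> 2"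
  obtains Q k where "alg_poly_fun n Q"
    "\<And>x. x 0 \<noteq> 0 \<Longrightarrow> Q x = x 0 ^ (2 * k) * P (invert_coord x)"
proof -
  have coord0: "alg_poly_fun n (\<lambda>x. x 0)" and coord1: "alg_poly_fun n (\<lambda>x. x 1)"
    using assms by (auto intro!: alg_poly_fun_coord)
  have "\<exists>Q k. alg_poly_fun n Q \<and> (\<forall>x. x 0 \<noteq> 0 \<longrightarrow> Q x = x 0 ^ (2 * k) * P (invert_coord x))"
    using assms(1)
  proof (induction rule: alg_poly_fun_induct)
    case (const c)
    then show ?case by (intro exI[of _ "\<lambda>_. c"] exI[of _ 0]) (simp add: alg_poly_fun_const)
  next
    case (coord i)
    consider "i = 0" | "i = 1" | "i > 1" by linarith
    then show ?case
    proof cases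
      case 1
      \<comment> \<open>For coordinate 0 one even power suffices:
        \<open>(x 0)\<^sup>2 * (- 1 / x 0) = - x 0\<close>.\<close>
      then show ?thesis
        by (intro exI[of _ "\<lambda>x. - x 0"] exI[of _ 1])
          (simp add: alg_poly_fun_uminus coord0 invert_coord_def power2_eq_square)
    next
      case 2
      then show ?thesis
        by (intro exI[of _ "\<lambda>x. (x 0)\<^sup>2 * x 1"] exI[of _ 0])
          (use alg_poly_fun_mult[OF alg_poly_fun_power[OF coord0] coord1] in \<open>simp add: invert_coord_def\<close>)
    next
      case 3
      then show ?thesis
        by (intro exI[of _ "\<lambda>x. x i"] exI[of _ 0])
          (simp add: alg_poly_fun_coord coord invert_coord_def)
    qed
  next
    case (add P1 P2)
    then obtain Q1 k1 Q2 k2 where Q: "alg_poly_fun n Q1" "alg_poly_fun n Q2"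
      "\<And>x. x 0 \<noteq> 0 \<Longrightarrow> Q1 x = x 0 ^ (2 * k1) * P1 (invert_coord x)"
      "\<And>x. x 0 \<noteq> 0 \<Longrightarrow> Q2 x = x 0 ^ (2 * k2) * P2 (invert_coord x)" by blast
    have "alg_poly_fun n (\<lambda>x. x 0 ^ (2 * k2) * Q1 x + x 0 ^ (2 * k1) * Q2 x)"
      by (intro alg_poly_fun_add alg_poly_fun_mult alg_poly_fun_power coord0 Q)
    moreover have "x 0 ^ (2 * k2) * Q1 x + x 0 ^ (2 * k1) * Q2 x
        = x 0 ^ (2 * (k1 + k2)) * (P1 (invert_coord x) + P2 (invert_coord x))" if "x 0 \<noteq> 0" for x
      by (simp add: Q that power_add algebra_simps)
    ultimately show ?case by blast
  next
    case (mult P1 P2)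
    then obtain Q1 k1 Q2 k2 where Q: "alg_poly_fun n Q1" "alg_poly_fun n Q2"
      "\<And>x. x 0 \<noteq> 0 \<Longrightarrow> Q1 x = x 0 ^ (2 * k1) * P1 (invert_coord x)"
      "\<And>x. x 0 \<noteq> 0 \<Longrightarrow> Q2 x = x 0 ^ (2 * k2) * P2 (invert_coord x)" by blast
    have "alg_poly_fun n (\<lambda>x. Q1 x * Q2 x)"
      by (intro alg_poly_fun_mult Q)
    moreover have "Q1 x * Q2 x
        = x 0 ^ (2 * (k1 + k2)) * (P1 (invert_coord x) * P2 (invert_coord x))" if "x 0 \<noteq> 0" for x
      by (simp add: Q that power_add algebra_simps)
    ultimately show ?case by blast
  qed
  then show ?thesis using that by blast
qed

lemma admissible_invert:
  assumes "admissible n S" "n \<ge> 2" and S0: "\<And>x. x \<in> S \<Longrightarrow> x 0 \<noteq> 0"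
  obtains S' where "admissible n S'" "vol_n n S' = vol_n n S"
    "\<And>x. x \<in> S' \<Longrightarrow> x 0 \<noteq> 0 \<and> invert_coord x \<in> S"
proof -
  \<comment> \<open>The condition \<open>x 0 \<noteq> 0\<close> is expressed as a strict polynomial
    inequality.\<close>
  define D :: "(nat \<Rightarrow> real) set" where "D = {x \<in> PiE {..<n} (\<lambda>_. UNIV). (x 0)\<^sup>2 > 0}"
  define S' where "S' = {x \<in> D. invert_coord x \<in> S}"
  have S: "semialgebraic n S" "emeasure (lebesgue_n n) S < \<infinity>"
    using assms by (auto simp: admissible_iff)
  have "semialgebraic n S'"
    unfolding S'_def
  proof (rule semialgebraic_pullback[OF S(1)])
    show "semialgebraic n D" unfolding D_def
      using assms(2) by (intro semialgebraic.gt alg_poly_fun_power alg_poly_fun_coord) auto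
    show "invert_coord x \<in> PiE {..<n} (\<lambda>_. UNIV)" if "x \<in> D" for x
      using that assms(2) by (simp add: D_def invert_coord_def PiE_iff fun_upd_extensional_iff)
    fix P assume "alg_poly_fun n P"
    then obtain Q k where Q: "alg_poly_fun n Q"
      "\<And>x. x 0 \<noteq> 0 \<Longrightarrow> Q x = x 0 ^ (2 * k) * P (invert_coord x)"
      using alg_poly_fun_invert_coord assms(2) by blast
    have pos: "x 0 ^ (2 * k) > 0" if "x \<in> D" for x
      using that by (simp add: D_def power_mult)
    show "\<exists>Q. alg_poly_fun n Q \<and> (\<forall>x\<in>D. (Q x > 0 \<longleftrightarrow> P (invert_coord x) > 0)
        \<and> (Q x \<ge> 0 \<longleftrightarrow> P (invert_coord x) \<ge> 0))"
    proof (intro exI[of _ Q] conjI ballI Q(1))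
      fix x assume x: "x \<in> D"
      then have "Q x = x 0 ^ (2 * k) * P (invert_coord x)" by (intro Q) (simp add: D_def)
      then show "Q x > 0 \<longleftrightarrow> P (invert_coord x) > 0" "Q x \<ge> 0 \<longleftrightarrow> P (invert_coord x) \<ge> 0"
        using pos[OF x] by (simp_all add: zero_less_mult_iff zero_le_mult_iff)
    qed
  qed
  moreover have "emeasure (lebesgue_n n) S = emeasure (lebesgue_n n) S'"
  proof -
    have "emeasure (lebesgue_n n) S = emeasure (distr (lebesgue_n n) (lebesgue_n n) invert_coord) S"
      using distr_invert_coord[OF assms(2)] by simp
    also have "\<dots> = emeasure (lebesgue_n n) (invert_coord -` S \<inter> space (lebesgue_n n))"
      using invert_coord_measurable[OF assms(2)] semialgebraic_sets[OF S(1)] by (rule emeasure_distr)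
    also have "invert_coord -` S \<inter> space (lebesgue_n n) = S'"
    proof -
      \<comment> \<open>Points with \<open>x 0 = 0\<close> have an image with coordinate 0 equal to
        0, hence outside \<open>S\<close>. So restricting to \<open>D\<close> loses nothing of the
        preimage.\<close>
      have "x 0 \<noteq> 0" if "invert_coord x \<in> S" for x
        using S0[OF that] by (auto simp: invert_coord_def)
      then show ?thesis by (auto simp: S'_def D_def space_lebesgue_n)
    qed
    finally show ?thesis .
  qed
  ultimately have "admissible n S'" "vol_n n S' = vol_n n S"
    using S(2) by (simp_all add: admissible_iff vol_n_def measure_def)
  moreover have "x 0 \<noteq> 0 \<and> invert_coord x \<in> S" if "x \<in> S'" for x
    using that by (simp add: S'_def D_def)
  ultimately show ?thesis by (rule that)
qed

section \<open>Unions and intersections of domains\<close>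

lemma admissible_empty: "admissible n {}"
  by (simp add: admissible_iff semialgebraic.empty)

lemma admissible_disjoint_Un:
  assumes "admissible n S" "admissible n T" "S \<inter> T = {}"
  shows "admissible n (S \<union> T)" "vol_n n (S \<union> T) = vol_n n S + vol_n n T"
proof -
  have S: "semialgebraic n S" "emeasure (lebesgue_n n) S < \<infinity>"
    "semialgebraic n T" "emeasure (lebesgue_n n) T < \<infinity>"
    using assms by (auto simp: admissible_iff)
  have "emeasure (lebesgue_n n) (S \<union> T) \<le> emeasure (lebesgue_n n) S + emeasure (lebesgue_n n) T"
    using S by (intro emeasure_subadditive semialgebraic_sets)
  also have "\<dots> < \<infinity>" using S by simp
  finally show "admissible n (S \<union> T)" using S by (simp add: admissible_iff semialgebraic.Un)
  show "vol_n n (S \<union> T) = vol_n n S + vol_n n T"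
    unfolding vol_n_def using S assms(3) by (intro measure_Union semialgebraic_sets) auto
qed

lemma admissible_Int:
  assumes "admissible n S" "semialgebraic n T"
  shows "admissible n (S \<inter> T)"
proof -
  have "emeasure (lebesgue_n n) (S \<inter> T) \<le> emeasure (lebesgue_n n) S"
    using assms by (intro emeasure_mono semialgebraic_sets) (auto simp: admissible_iff)
  then show ?thesis using assms by (auto simp: admissible_iff semialgebraic.Int intro: le_less_trans)
qed

text \<open>Beyond its largest root a nonzero polynomial cannot change sign, by the intermediate
  value theorem.\<close>

lemma poly_sgn_eventually_constant:
  fixes q :: "real poly"
  obtains N where "\<And>x y. x > N \<Longrightarrow> y > N \<Longrightarrow> sgn (poly q x) = sgn (poly q y)"
proof (cases "q = 0")
  case True
  then show ?thesis using that[of 0] by simp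
next
  case False
  then have "finite {x. poly q x = 0}" by (rule poly_roots_finite)
  then obtain N where N: "\<And>x. poly q x = 0 \<Longrightarrow> x \<le> N"
    using bdd_above_finite[of "{x. poly q x = 0}"] unfolding bdd_above_def by blast
  have le: "sgn (poly q x) = sgn (poly q y)" if xy: "N < x" "x < y" for x y
  proof (rule ccontr)
    assume neq: "sgn (poly q x) \<noteq> sgn (poly q y)"
    have "poly q x \<noteq> 0" "poly q y \<noteq> 0" using N[of x] N[of y] xy by linarith+
    with neq have "poly q x < 0 \<and> 0 < poly q y \<or> 0 < poly q x \<and> poly q y < 0"
      by (auto simp: sgn_if split: if_splits)
    then obtain z where "x < z" "poly q z = 0"
      using poly_IVT_pos[OF xy(2), of q] poly_IVT_neg[OF xy(2), of q] by blast
    then show False using N[of z] xy by simp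
  qed
  show ?thesis
  proof (rule that[of N])
    fix x y assume xy: "x > N" "y > N"
    show "sgn (poly q x) = sgn (poly q y)"
      by (cases x y rule: linorder_cases) (simp_all only: le[OF xy(1)] le[OF xy(2), symmetric])
  qed
qed

text \<open>Each defining inequality is eventually constant towards either end of the line, and
  unions and intersections inherit this with the larger threshold. The two ends are kept apart
  because a polynomial of odd degree has opposite signs there.\<close>

lemma semialgebraic_1_eventually_constant:
  assumes "semialgebraic 1 S"
  obtains N where "\<And>x y. x \<in> PiE {..<1} (\<lambda>_. UNIV) \<Longrightarrow> y \<in> PiE {..<1} (\<lambda>_. UNIV) \<Longrightarrow>
    x 0 > N \<and> y 0 > N \<or> x 0 < - N \<and> y 0 < - N \<Longrightarrow> x \<in> S \<longleftrightarrow> y \<in> S"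
proof -
  let ?E = "\<lambda>N x y. x 0 > N \<and> y 0 > N \<or> x 0 < - N \<and> y 0 < (- N :: real)"
  have sgn: "\<exists>N. \<forall>x y. ?E N x y \<longrightarrow> sgn (P x) = sgn (P y)" if P: "alg_poly_fun 1 P" for P
  proof -
    obtain q where q: "\<And>x. P x = poly q (x 0)" using alg_poly_fun_1_poly[OF P] by blast
    obtain N1 where N1: "\<And>x y. x > N1 \<Longrightarrow> y > N1 \<Longrightarrow> sgn (poly q x) = sgn (poly q y)"
      using poly_sgn_eventually_constant by blast
    \<comment> \<open>Composition with \<open>[:0, -1:]\<close> reflects the line, turning behaviour
      near minus infinity into behaviour near plus infinity.\<close>
    obtain N2 where N2: "\<And>x y. x > N2 \<Longrightarrow> y > N2 \<Longrightarrow>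
        sgn (poly (pcompose q [:0, -1:]) x) = sgn (poly (pcompose q [:0, -1:]) y)"
      using poly_sgn_eventually_constant by blast
    have N2': "sgn (poly q x) = sgn (poly q y)" if "x < - N2" "y < - N2" for x y
      using N2[of "- x" "- y"] that by (simp add: poly_pcompose)
    show ?thesis
      by (rule exI[of _ "max N1 N2"]) (auto simp: q intro: N1 N2')
  qed
  define EC where "EC U N \<longleftrightarrow> (\<forall>x\<in>PiE {..<1} (\<lambda>_. UNIV). \<forall>y\<in>PiE {..<1} (\<lambda>_. UNIV).
    ?E N x y \<longrightarrow> (x \<in> U \<longleftrightarrow> y \<in> U))" for U :: "(nat \<Rightarrow> real) set" and N
  have EC_D: "x \<in> U \<longleftrightarrow> y \<in> U"
    if "EC U N" "x \<in> PiE {..<1} (\<lambda>_. UNIV)" "y \<in> PiE {..<1} (\<lambda>_. UNIV)" "?E N x y" for U N x y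
    by (rule that(1)[unfolded EC_def, rule_format, OF that(2-4)])
  have "\<exists>N. EC S N"
    using assms
  proof induction
    case (ge P)
    from sgn[OF ge] obtain N where N: "\<And>x y. ?E N x y \<Longrightarrow> sgn (P x) = sgn (P y)" by blast
    show ?case
      unfolding EC_def
    proof (intro exI[of _ N] ballI impI)
      fix x y :: "nat \<Rightarrow> real"
      assume xy: "x \<in> PiE {..<1} (\<lambda>_. UNIV)" "y \<in> PiE {..<1} (\<lambda>_. UNIV)" "?E N x y"
      have "P x \<ge> 0 \<longleftrightarrow> P y \<ge> 0" using N[of x y] xy(3) by (metis sgn_less linorder_not_less)
      then show "x \<in> {x \<in> PiE {..<1} (\<lambda>_. UNIV). P x \<ge> 0} \<longleftrightarrow> y \<in> {x \<in> PiE {..<1} (\<lambda>_. UNIV). P x \<ge> 0}"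
        using xy(1,2) by simp
    qed
  next
    case (gt P)
    from sgn[OF gt] obtain N where N: "\<And>x y. ?E N x y \<Longrightarrow> sgn (P x) = sgn (P y)" by blast
    show ?case
      unfolding EC_def
    proof (intro exI[of _ N] ballI impI)
      fix x y :: "nat \<Rightarrow> real"
      assume xy: "x \<in> PiE {..<1} (\<lambda>_. UNIV)" "y \<in> PiE {..<1} (\<lambda>_. UNIV)" "?E N x y"
      have "P x > 0 \<longleftrightarrow> P y > 0" using N[of x y] xy(3) by (metis sgn_greater)
      then show "x \<in> {x \<in> PiE {..<1} (\<lambda>_. UNIV). P x > 0} \<longleftrightarrow> y \<in> {x \<in> PiE {..<1} (\<lambda>_. UNIV). P x > 0}"
        using xy(1,2) by simp
    qed
  next
    case (Int S T)
    then obtain N1 N2 where N: "EC S N1" "EC T N2" by blast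
    show ?case
      unfolding EC_def
    proof (intro exI[of _ "max N1 N2"] ballI impI)
      fix x y :: "nat \<Rightarrow> real"
      assume xy: "x \<in> PiE {..<1} (\<lambda>_. UNIV)" "y \<in> PiE {..<1} (\<lambda>_. UNIV)" "?E (max N1 N2) x y"
      have E: "?E N1 x y" "?E N2 x y" using xy(3) by linarith+
      show "x \<in> S \<inter> T \<longleftrightarrow> y \<in> S \<inter> T"
        using EC_D[OF N(1) xy(1,2) E(1)] EC_D[OF N(2) xy(1,2) E(2)] by simp
    qed
  next
    case (Un S T)
    then obtain N1 N2 where N: "EC S N1" "EC T N2" by blast
    show ?case
      unfolding EC_def
    proof (intro exI[of _ "max N1 N2"] ballI impI)
      fix x y :: "nat \<Rightarrow> real"
      assume xy: "x \<in> PiE {..<1} (\<lambda>_. UNIV)" "y \<in> PiE {..<1} (\<lambda>_. UNIV)" "?E (max N1 N2) x y"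
      have E: "?E N1 x y" "?E N2 x y" using xy(3) by linarith+
      show "x \<in> S \<union> T \<longleftrightarrow> y \<in> S \<union> T"
        using EC_D[OF N(1) xy(1,2) E(1)] EC_D[OF N(2) xy(1,2) E(2)] by simp
    qed
  qed (auto simp: EC_def)
  then obtain N where "EC S N" by blast
  then show ?thesis using that[of N] EC_D[of S N] by simp
qed

lemma emeasure_lebesgue_1_box:
  assumes "A \<in> sets borel"
  shows "emeasure (lebesgue_n 1) (PiE {..<1} (\<lambda>_. A)) = emeasure lborel A"
  using emeasure_lebesgue_n_box[of 1 "\<lambda>_. A"] assms by simp

text \<open>A point of \<open>S\<close> beyond the threshold would force a whole ray into
  \<open>S\<close>, contradicting finite volume.\<close>

lemma admissible_1_bounded:
  assumes "admissible 1 S"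
  obtains N :: nat where "\<And>x. x \<in> S \<Longrightarrow> \<bar>x 0\<bar> \<le> real N"
proof -
  have S: "semialgebraic 1 S" "emeasure (lebesgue_n 1) S < \<infinity>"
    using assms by (auto simp: admissible_iff)
  obtain M where M: "\<And>x y. x \<in> PiE {..<1} (\<lambda>_. UNIV) \<Longrightarrow> y \<in> PiE {..<1} (\<lambda>_. UNIV) \<Longrightarrow>
    x 0 > M \<and> y 0 > M \<or> x 0 < - M \<and> y 0 < - M \<Longrightarrow> x \<in> S \<longleftrightarrow> y \<in> S"
    using semialgebraic_1_eventually_constant[OF S(1)] by blast
  \<comment> \<open>A set containing intervals of every length \<open>k\<close> has measure at least
    every \<open>k\<close>.\<close>
  have no_ray: False if A: "A \<in> sets borel" "PiE {..<1} (\<lambda>_. A) \<subseteq> S"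
    and unb: "\<And>k::nat. \<exists>c. {c..c + real k} \<subseteq> A" for A :: "real set"
  proof -
    have "ennreal (real k) \<le> emeasure (lebesgue_n 1) S" for k
    proof -
      obtain c where c: "{c..c + real k} \<subseteq> A" using unb by blast
      have "ennreal (real k) = emeasure lborel {c..c + real k}" by simp
      also have "\<dots> \<le> emeasure lborel A" using c A by (intro emeasure_mono) auto
      also have "\<dots> = emeasure (lebesgue_n 1) (PiE {..<1} (\<lambda>_. A))"
        using A(1) by (rule emeasure_lebesgue_1_box[symmetric])
      also have "\<dots> \<le> emeasure (lebesgue_n 1) S"
        using A(2) S(1) by (intro emeasure_mono semialgebraic_sets)
      finally show ?thesis .
    qed
    moreover obtain r where r: "r \<ge> 0" "emeasure (lebesgue_n 1) S = ennreal r"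
      using S(2) by (cases "emeasure (lebesgue_n 1) S") auto
    ultimately have "real k \<le> r" for k by (metis ennreal_le_iff)
    then show False using reals_Archimedean2[of r] by (meson not_less)
  qed
  \<comment> \<open>The threshold \<open>M\<close> may be negative, hence its absolute
    value.\<close>
  have "\<bar>x 0\<bar> \<le> \<bar>M\<bar>" if x: "x \<in> S" for x
  proof (rule ccontr)
    assume "\<not> \<bar>x 0\<bar> \<le> \<bar>M\<bar>"
    then consider "x 0 > M" | "x 0 < - M" by linarith
    then show False
    proof cases
      case 1
      have "PiE {..<1} (\<lambda>_. {M<..}) \<subseteq> S"
      proof
        fix y :: "nat \<Rightarrow> real" assume y: "y \<in> PiE {..<1} (\<lambda>_. {M<..})"
        then have "y 0 > M" "y \<in> PiE {..<1} (\<lambda>_. UNIV)" by (auto simp: PiE_iff)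
        then show "y \<in> S" using M[of x y] x 1 semialgebraic_subset[OF S(1)] by blast
      qed
      moreover have "\<exists>c. {c..c + real k} \<subseteq> {M<..}" for k
        by (rule exI[of _ "M + 1"]) auto
      ultimately show False using no_ray[of "{M<..}"] by simp
    next
      case 2
      have "PiE {..<1} (\<lambda>_. {..<- M}) \<subseteq> S"
      proof
        fix y :: "nat \<Rightarrow> real" assume y: "y \<in> PiE {..<1} (\<lambda>_. {..<- M})"
        then have "y 0 < - M" "y \<in> PiE {..<1} (\<lambda>_. UNIV)" by (auto simp: PiE_iff)
        then show "y \<in> S" using M[of x y] x 2 semialgebraic_subset[OF S(1)] by blast
      qed
      moreover have "\<exists>c. {c..c + real k} \<subseteq> {..<- M}" for k
        by (rule exI[of _ "- M - 1 - real k"]) auto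
      ultimately show False using no_ray[of "{..<- M}"] by simp
    qed
  qed
  moreover obtain N :: nat where "\<bar>M\<bar> \<le> real N" using real_arch_simple by blast
  ultimately show ?thesis using that[of N] by (meson order_trans)
qed

text \<open>Boundedness in direction \<open>x 0\<close> alone is enough for making domains disjoint
  by translation. In dimension at least 2 the domain is cut at \<open>\<bar>x 0\<bar> = 1\<close>,
  and the outer part is inverted and then shifted away from the inner one.\<close>

lemma admissible_bounded_representative:
  assumes "admissible n S" "n > 0"
  obtains S' N where "admissible n S'" "vol_n n S' = vol_n n S"
    "\<And>x. x \<in> S' \<Longrightarrow> \<bar>x 0\<bar> \<le> real N"
proof (cases "n = 1")
  case True
  then show ?thesis using admissible_1_bounded assms(1) that by metis
next
  case False
  then have n: "n \<ge> 2" using assms by simp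
  define I :: "(nat \<Rightarrow> real) set" where "I = {x \<in> PiE {..<n} (\<lambda>_. UNIV). 1 - (x 0)\<^sup>2 \<ge> 0}"
  define J :: "(nat \<Rightarrow> real) set" where "J = {x \<in> PiE {..<n} (\<lambda>_. UNIV). (x 0)\<^sup>2 - 1 > 0}"
  have IJ: "semialgebraic n I" "semialgebraic n J"
    unfolding I_def J_def using assms(2)
    by (intro semialgebraic.ge semialgebraic.gt alg_poly_fun_diff alg_poly_fun_const
        alg_poly_fun_power alg_poly_fun_coord algebraic_1; simp)+
  have I: "\<bar>x 0\<bar> \<le> 1" if "x \<in> I" for x
    using that by (simp add: I_def abs_square_le_1)
  have J: "\<bar>x 0\<bar> > 1" if "x \<in> J" for x
    using that by (simp add: J_def) (metis abs_square_le_1 linorder_not_less)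
  have adm: "admissible n (S \<inter> I)" "admissible n (S \<inter> J)"
    using assms IJ by (auto intro: admissible_Int)
  have S: "S = (S \<inter> I) \<union> (S \<inter> J)" "(S \<inter> I) \<inter> (S \<inter> J) = {}"
    using semialgebraic_subset[of n S] assms(1) by (auto simp: I_def J_def admissible_iff)
  \<comment> \<open>On \<open>J\<close> the coordinate \<open>x 0\<close> exceeds 1 in absolute
    value, so it is nonzero as the inversion requires, and the inverted part lands in
    \<open>\<bar>x 0\<bar> < 1\<close>.\<close>
  obtain T where T: "admissible n T" "vol_n n T = vol_n n (S \<inter> J)"
    "\<And>x. x \<in> T \<Longrightarrow> x 0 \<noteq> 0 \<and> invert_coord x \<in> S \<inter> J"
    by (rule admissible_invert[OF adm(2) n]) (use J in force)+
  have T1: "\<bar>x 0\<bar> < 1" if "x \<in> T" for x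
  proof -
    have "\<bar>invert_coord x 0\<bar> > 1" "x 0 \<noteq> 0" using T(3)[OF that] J by auto
    then show ?thesis by (simp add: invert_coord_def)
  qed
  \<comment> \<open>Shifting by 3 moves the inverted part into \<open>2 < x 0 < 4\<close>, clear of
    the inner part in \<open>\<bar>x 0\<bar> \<le> 1\<close>; hence the final bound 4.\<close>
  obtain U where U: "admissible n U" "vol_n n U = vol_n n T"
    "\<And>x. x \<in> U \<Longrightarrow> x(0 := x 0 - real 3) \<in> T"
    using admissible_translate[OF T(1) assms(2)] by blast
  have U1: "2 < x 0 \<and> x 0 < 4" if "x \<in> U" for x
    using T1[OF U(3)[OF that]] by (simp add: abs_less_iff)
  have disj: "(S \<inter> I) \<inter> U = {}"
  proof (rule ccontr)
    assume "\<not> ?thesis"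
    then obtain x where "x \<in> I" "x \<in> U" by blast
    then show False using U1[of x] I[of x] by simp
  qed
  show ?thesis
  proof (rule that[of "(S \<inter> I) \<union> U" 4])
    show "admissible n ((S \<inter> I) \<union> U)"
      by (rule admissible_disjoint_Un[OF adm(1) U(1) disj])
    show "vol_n n ((S \<inter> I) \<union> U) = vol_n n S"
      using admissible_disjoint_Un(2)[OF adm(1) U(1) disj] admissible_disjoint_Un(2)[OF adm S(2)]
        S(1) U(2) T(2) by simp
    show "\<bar>x 0\<bar> \<le> real 4" if "x \<in> (S \<inter> I) \<union> U" for x
      using that I[of x] U1[of x] by auto
  qed
qed

lemma admissible_sum:
  assumes "admissible n S" "admissible n T" "n > 0"
  obtains U where "admissible n U" "vol_n n U = vol_n n S + vol_n n T"
proof -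
  obtain S' K where S': "admissible n S'" "vol_n n S' = vol_n n S" "\<And>x. x \<in> S' \<Longrightarrow> \<bar>x 0\<bar> \<le> real K"
    using admissible_bounded_representative[OF assms(1,3)] by blast
  obtain T' N where T': "admissible n T'" "vol_n n T' = vol_n n T" "\<And>x. x \<in> T' \<Longrightarrow> \<bar>x 0\<bar> \<le> real N"
    using admissible_bounded_representative[OF assms(2,3)] by blast
  \<comment> \<open>After this shift \<open>x 0 \<ge> K + 1\<close> holds on \<open>T''\<close>,
    whereas \<open>x 0 \<le> K\<close> on \<open>S'\<close>.\<close>
  obtain T'' where T'': "admissible n T''" "vol_n n T'' = vol_n n T'"
    "\<And>x. x \<in> T'' \<Longrightarrow> x(0 := x 0 - real (K + N + 1)) \<in> T'"
    using admissible_translate[OF T'(1) assms(3)] by blast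
  have "S' \<inter> T'' = {}"
  proof (rule ccontr)
    assume "\<not> ?thesis"
    then obtain x where "x \<in> S'" "x \<in> T''" by blast
    then show False using S'(3)[of x] T'(3)[OF T''(3), of x] by (simp add: abs_le_iff)
  qed
  from admissible_disjoint_Un[OF S'(1) T''(1) this] show ?thesis
    using that S'(2) T'(2) T''(2) by simp
qed

text \<open>The conditions of \<open>S\<close> are imposed on the first \<open>n\<close> coordinates
  and those of \<open>T\<close> on the last \<open>m\<close>; under \<open>append_coords\<close>
  this set corresponds to the product of \<open>S\<close> and \<open>T\<close>.\<close>

lemma admissible_product:
  assumes "admissible n S" "admissible m T"
  obtains U where "admissible (n + m) U" "vol_n (n + m) U = vol_n n S * vol_n m T"
proof -
  let ?E = "PiE {..<n + m} (\<lambda>_. UNIV :: real set)"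
  define f where "f z = restrict z {..<n}" for z :: "nat \<Rightarrow> real"
  define g where "g z = (\<lambda>j\<in>{..<m}. z (n + j))" for z :: "nat \<Rightarrow> real"
  define U where "U = {z \<in> ?E. f z \<in> S} \<inter> {z \<in> ?E. g z \<in> T}"
  have S: "semialgebraic n S" "emeasure (lebesgue_n n) S < \<infinity>"
    and T: "semialgebraic m T" "emeasure (lebesgue_n m) T < \<infinity>"
    using assms by (auto simp: admissible_iff)
  have "semialgebraic (n + m) {z \<in> ?E. f z \<in> S}"
    by (rule semialgebraic_poly_pullback[OF S(1)]) (auto simp: f_def intro: alg_poly_fun_coord)
  moreover have "semialgebraic (n + m) {z \<in> ?E. g z \<in> T}"
    by (rule semialgebraic_poly_pullback[OF T(1)]) (auto simp: g_def intro: alg_poly_fun_coord)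
  ultimately have U: "semialgebraic (n + m) U" unfolding U_def by (rule semialgebraic.Int)
  interpret m: sigma_finite_measure "lebesgue_n m"
    unfolding lebesgue_n_def by (rule lborel_product.sigma_finite) simp
  have "emeasure (lebesgue_n (n + m)) U
      = emeasure (distr (lebesgue_n n \<Otimes>\<^sub>M lebesgue_n m) (lebesgue_n (n + m)) (append_coords n m)) U"
    by (simp add: distr_append_coords)
  also have "\<dots> = emeasure (lebesgue_n n \<Otimes>\<^sub>M lebesgue_n m)
      (append_coords n m -` U \<inter> space (lebesgue_n n \<Otimes>\<^sub>M lebesgue_n m))"
    using semialgebraic_sets[OF U] by (intro emeasure_distr append_coords_measurable)
  also have "append_coords n m -` U \<inter> space (lebesgue_n n \<Otimes>\<^sub>M lebesgue_n m) = S \<times> T"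
  proof -
    have "append_coords n m (x, y) \<in> U \<longleftrightarrow> x \<in> S \<and> y \<in> T"
      if "x \<in> PiE {..<n} (\<lambda>_. UNIV)" "y \<in> PiE {..<m} (\<lambda>_. UNIV)" for x y
    proof -
      have "f (append_coords n m (x, y)) = x"
        by (rule extensionalityI[of _ "{..<n}"])
          (use that in \<open>auto simp: f_def append_coords_def PiE_iff\<close>)
      moreover have "g (append_coords n m (x, y)) = y"
        by (rule extensionalityI[of _ "{..<m}"])
          (use that in \<open>auto simp: g_def append_coords_def PiE_iff\<close>)
      ultimately show ?thesis by (simp add: U_def append_coords_def PiE_iff)
    qed
    then show ?thesis
      using subsetD[OF semialgebraic_subset[OF S(1)]] subsetD[OF semialgebraic_subset[OF T(1)]]
      by (force simp: space_pair_measure space_lebesgue_n)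
  qed
  also have "emeasure (lebesgue_n n \<Otimes>\<^sub>M lebesgue_n m) (S \<times> T)
      = emeasure (lebesgue_n n) S * emeasure (lebesgue_n m) T"
    using S T by (intro m.emeasure_pair_measure_Times semialgebraic_sets)
  finally have e: "emeasure (lebesgue_n (n + m)) U
      = emeasure (lebesgue_n n) S * emeasure (lebesgue_n m) T" .
  show ?thesis
  proof (rule that[of U])
    show "admissible (n + m) U"
      using U S T by (simp add: admissible_iff e ennreal_mult_less_top)
    show "vol_n (n + m) U = vol_n n S * vol_n m T"
      by (simp add: vol_n_def measure_def e enn2real_mult)
  qed
qed

subsection \<open>Degrees of periods\<close>

lemma real_period_dim_uminus: "real_period_dim n p \<Longrightarrow> real_period_dim n (- p)"
  unfolding real_period_dim_def by (metis minus_diff_eq)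

lemma real_period_dim_0: "real_period_dim n 0"
  unfolding real_period_dim_def by (intro exI[of _ "{}"]) (simp add: admissible_empty)

lemma real_period_dim_vol: "admissible n S \<Longrightarrow> real_period_dim n (vol_n n S)"
  unfolding real_period_dim_def
  by (intro exI[of _ S] exI[of _ "{}"]) (simp add: admissible_empty vol_n_def)

lemma real_period_dim_add:
  assumes "real_period_dim n p" "real_period_dim n q" "n > 0"
  shows "real_period_dim n (p + q)"
proof -
  obtain S1 S2 T1 T2 where S: "admissible n S1" "admissible n S2" "p = vol_n n S1 - vol_n n S2"
    and T: "admissible n T1" "admissible n T2" "q = vol_n n T1 - vol_n n T2"
    using assms unfolding real_period_dim_def by blast
  obtain U1 where U1: "admissible n U1" "vol_n n U1 = vol_n n S1 + vol_n n T1"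
    using admissible_sum[OF S(1) T(1) assms(3)] by blast
  obtain U2 where U2: "admissible n U2" "vol_n n U2 = vol_n n S2 + vol_n n T2"
    using admissible_sum[OF S(2) T(2) assms(3)] by blast
  show ?thesis
    unfolding real_period_dim_def
    by (intro exI[of _ U1] exI[of _ U2]) (simp add: U1 U2 S T)
qed

lemma real_period_dim_diff:
  assumes "real_period_dim n p" "real_period_dim n q" "n > 0"
  shows "real_period_dim n (p - q)"
  using real_period_dim_add[OF assms(1) real_period_dim_uminus[OF assms(2)] assms(3)] by simp

text \<open>Expanding the product of two differences gives four products of volumes, all in
  dimension \<open>n + m\<close>, where they can be added and subtracted.\<close>

lemma real_period_dim_mult:
  assumes "real_period_dim n p" "real_period_dim m q" "n + m > 0"
  shows "real_period_dim (n + m) (p * q)"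
proof -
  obtain S1 S2 T1 T2 where S: "admissible n S1" "admissible n S2" "p = vol_n n S1 - vol_n n S2"
    and T: "admissible m T1" "admissible m T2" "q = vol_n m T1 - vol_n m T2"
    using assms unfolding real_period_dim_def by blast
  have prod: "real_period_dim (n + m) (vol_n n S * vol_n m T)"
    if "admissible n S" "admissible m T" for S T
    using admissible_product[OF that] by (metis real_period_dim_vol)
  have "real_period_dim (n + m) ((vol_n n S1 * vol_n m T1 + vol_n n S2 * vol_n m T2)
      - (vol_n n S1 * vol_n m T2 + vol_n n S2 * vol_n m T1))"
    by (intro real_period_dim_diff real_period_dim_add prod S T assms(3))
  also have "(vol_n n S1 * vol_n m T1 + vol_n n S2 * vol_n m T2)
      - (vol_n n S1 * vol_n m T2 + vol_n n S2 * vol_n m T1) = p * q"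
    by (simp add: S T algebra_simps)
  finally show ?thesis .
qed

text \<open>A nonnegative algebraic number is the length of the interval from 0 to it; negative ones
  follow by exchanging the two domains.\<close>

lemma real_period_dim_1_algebraic:
  assumes "algebraic a"
  shows "real_period_dim 1 a"
proof -
  have nonneg: "real_period_dim 1 b" if "algebraic b" "b \<ge> 0" for b
  proof -
    define S :: "(nat \<Rightarrow> real) set" where
      "S = {x \<in> PiE {..<1} (\<lambda>_. UNIV). x 0 \<ge> 0} \<inter> {x \<in> PiE {..<1} (\<lambda>_. UNIV). b - x 0 \<ge> 0}"
    have "semialgebraic 1 S"
      unfolding S_def using that(1)
      by (intro semialgebraic.Int semialgebraic.ge alg_poly_fun_diff alg_poly_fun_const alg_poly_fun_coord) auto
    moreover have "S = PiE {..<1} (\<lambda>_. {0..b})"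
    proof (rule set_eqI)
      fix x :: "nat \<Rightarrow> real"
      have "x \<in> PiE {..<1} (\<lambda>_. A) \<longleftrightarrow> x 0 \<in> A \<and> x \<in> extensional {..<1}" for A
        by (simp only: PiE_iff Ball_def lessThan_iff less_one simp_thms)
      then show "x \<in> S \<longleftrightarrow> x \<in> PiE {..<1} (\<lambda>_. {0..b})"
        by (simp only: S_def Int_iff mem_Collect_eq atLeastAtMost_iff UNIV_I diff_ge_0_iff_ge) blast
    qed
    then have "emeasure (lebesgue_n 1) S = ennreal b"
      using emeasure_lebesgue_1_box[of "{0..b}"] that(2) by simp
    ultimately have "admissible 1 S" "vol_n 1 S = b"
      using that(2) by (auto simp: admissible_iff vol_n_def measure_def)
    then show ?thesis using real_period_dim_vol by blast
  qed
  show ?thesis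
  proof (cases "a \<ge> 0")
    case False
    then have "real_period_dim 1 (- a)" using assms by (intro nonneg) auto
    then show ?thesis using real_period_dim_uminus by fastforce
  qed (use nonneg assms in simp)
qed

text \<open>Multiplying by 1, itself a period in dimension 1, raises the dimension by one.\<close>

lemma real_period_dim_mono:
  assumes "real_period_dim n p" "n \<le> m" "n > 0"
  shows "real_period_dim m p"
  using assms(2)
proof (induction rule: dec_induct)
  case (step k)
  have "real_period_dim (k + 1) (p * 1)"
    using step real_period_dim_1_algebraic[of 1] by (intro real_period_dim_mult) auto
  then show ?case by simp
qed (rule assms(1))

section \<open>Degree bounds and representations in a given dimension\<close>

lemma real_deg_0 [simp]: "real_deg 0 = 0"
  by (simp add: real_deg_def)

lemma deg_0 [simp]: "deg 0 = 0"
  by (simp add: deg_def)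

lemma real_deg_le:
  assumes "n \<ge> 1" "real_period_dim n p"
  shows "real_deg p \<le> n"
  using assms by (auto simp: real_deg_def intro: Least_le)

lemma real_deg_pos_dim:
  assumes "real_period p" "p \<noteq> 0"
  shows "real_deg p \<ge> 1" "real_period_dim (real_deg p) p"
proof -
  have "\<exists>n. n \<ge> 1 \<and> real_period_dim n p" using assms(1) by (auto simp: real_period_def)
  from LeastI_ex[OF this] show "real_deg p \<ge> 1" "real_period_dim (real_deg p) p"
    using assms(2) by (simp_all add: real_deg_def)
qed

text \<open>This brings numbers of different degrees, such as the two parts of a complex period, to
  a common dimension. Zero is treated apart, its degree being set to 0 by convention.\<close>

lemma real_period_dim_if_real_deg_le:
  assumes "real_period p" "real_deg p \<le> n"
  shows "real_period_dim n p"
proof (cases "p = 0")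
  case False
  note d = real_deg_pos_dim[OF assms(1) this]
  show ?thesis by (rule real_period_dim_mono[OF d(2) assms(2)]) (use d(1) in simp)
qed (simp add: real_period_dim_0)

lemma real_period_dim_deg:
  assumes "period z" "deg z \<le> n"
  shows "real_period_dim n (Re z)" "real_period_dim n (Im z)"
  using assms by (auto simp: period_def deg_def intro: real_period_dim_if_real_deg_le)

lemma deg_pos:
  assumes "period z" "z \<noteq> 0"
  shows "deg z \<ge> 1"
proof -
  have "Re z \<noteq> 0 \<or> Im z \<noteq> 0" using assms(2) by (simp add: complex_eq_iff)
  then show ?thesis
    using real_deg_pos_dim(1) assms(1) by (force simp: deg_def period_def max_def)
qed

lemma period_deg_leI:
  assumes "n \<ge> 1" "real_period_dim n (Re z)" "real_period_dim n (Im z)"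
  shows "period z" "deg z \<le> n"
  using assms by (auto simp: period_def real_period_def deg_def intro: real_deg_le)

lemma period_0: "period 0"
  by (rule period_deg_leI[of 1]) (simp_all add: real_period_dim_0)

text \<open>Each part of \<open>p * q\<close> is a sum or difference of two products of parts, each
  representable in dimension \<open>deg p + deg q\<close>.\<close>

lemma period_mult:
  assumes "period p" "period q"
  shows "period (p * q)" "deg (p * q) \<le> deg p + deg q"
proof -
  have "period (p * q) \<and> deg (p * q) \<le> deg p + deg q"
  \<comment> \<open>With both factors nonzero the sum of degrees is at least 1, the least dimension
    allowed in the definition of the degree.\<close>
  proof (cases "p = 0 \<or> q = 0")
    case True
    then show ?thesis by (auto simp: period_0)
  next
    case False
    then have pos: "deg p + deg q \<ge> 1" using deg_pos assms(1) by fastforce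
    note p = real_period_dim_deg[OF assms(1) order_refl]
    note q = real_period_dim_deg[OF assms(2) order_refl]
    have "real_period_dim (deg p + deg q) (Re (p * q))" "real_period_dim (deg p + deg q) (Im (p * q))"
      using pos by (auto intro!: real_period_dim_add real_period_dim_diff real_period_dim_mult p q)
    from period_deg_leI[OF pos this] show ?thesis by blast
  qed
  then show "period (p * q)" "deg (p * q) \<le> deg p + deg q" by blast+
qed

lemma period_add:
  assumes "period p" "period q"
  shows "period (p + q)" "deg (p + q) \<le> max (deg p) (deg q)"
proof -
  have "period (p + q) \<and> deg (p + q) \<le> max (deg p) (deg q)"
  proof (cases "p = 0 \<and> q = 0")
    case True
    then show ?thesis by (simp add: period_0)
  next
    case False
    then have pos: "max (deg p) (deg q) \<ge> 1" using deg_pos assms by (metis max.coboundedI1 max.coboundedI2)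
    note p = real_period_dim_deg[OF assms(1) max.cobounded1[of _ "deg q"]]
    note q = real_period_dim_deg[OF assms(2) max.cobounded2[of _ "deg p"]]
    have "real_period_dim (max (deg p) (deg q)) (Re (p + q))"
      "real_period_dim (max (deg p) (deg q)) (Im (p + q))"
      using pos by (auto intro!: real_period_dim_add p q)
    from period_deg_leI[OF pos this] show ?thesis by blast
  qed
  then show "period (p + q)" "deg (p + q) \<le> max (deg p) (deg q)" by blast+
qed

lemma period_algebraic:
  assumes "algebraic z"
  shows "period z" "deg z \<le> 1"
  using period_deg_leI[OF order_refl] real_period_dim_1_algebraic algebraic_complex_Re_Im[OF assms]
  by blast+

lemma period_power:
  assumes "period p"
  shows "period (p ^ Suc k)" "deg (p ^ Suc k) \<le> Suc k * deg p"
proof (induction k)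
  case 0
  {
    case 1 show ?case using assms by simp
  next
    case 2 show ?case by simp
  }
next
  case (Suc k)
  {
    case 1 show ?case using period_mult(1)[OF assms Suc(1)] by simp
  next
    case 2 show ?case using period_mult(2)[OF assms Suc(1)] Suc(2) by simp
  }
qed

subsection \<open>Zeta functions\<close>

text \<open>The bound on the degree of the power by \<open>Suc m * deg p\<close> cancels the
  denominator, leaving the terms of a geometric series.\<close>

lemma zeta_term_bounds:
  assumes "period p" "0 \<le> (t::real)"
  shows "0 \<le> t ^ Suc m * real (deg (p ^ Suc m)) / real (Suc m)"
    "t ^ Suc m * real (deg (p ^ Suc m)) / real (Suc m) \<le> t ^ Suc m * real (deg p)"
proof -
  show "0 \<le> t ^ Suc m * real (deg (p ^ Suc m)) / real (Suc m)" using assms by simp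
  have "real (deg (p ^ Suc m)) \<le> real (Suc m) * real (deg p)"
    using period_power(2)[OF assms(1), of m] unfolding of_nat_mult[symmetric] of_nat_le_iff .
  then have "t ^ Suc m * real (deg (p ^ Suc m)) \<le> t ^ Suc m * (real (Suc m) * real (deg p))"
    using assms(2) by (intro mult_left_mono) auto
  then show "t ^ Suc m * real (deg (p ^ Suc m)) / real (Suc m) \<le> t ^ Suc m * real (deg p)"
    by (simp add: pos_divide_le_eq mult_ac del: of_nat_Suc power_Suc)
qed

lemma geometric_Suc_sums:
  assumes "0 \<le> (t::real)" "t < 1"
  shows "(\<lambda>m. t ^ Suc m * c) sums (t * c / (1 - t))"
  using sums_mult[OF geometric_sums[of t], of "t * c"] assms by (simp add: mult_ac)

lemma summable_zeta_terms:
  assumes "period p" "0 \<le> (t::real)" "t < 1"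
  shows "summable (\<lambda>m. t ^ Suc m * real (deg (p ^ Suc m)) / real (Suc m))"
  by (rule summable_comparison_test'[OF sums_summable[OF geometric_Suc_sums[OF assms(2,3), of "real (deg p)"]], of 0])
    (use zeta_term_bounds[OF assms(1,2)] in \<open>simp only: real_norm_def abs_of_nonneg\<close>)

text \<open>The separate bound \<open>d\<close> covers both the estimate by the degree of the period
  itself and that of a sum by the larger degree of its summands.\<close>

lemma period_zeta_le:
  assumes "period p" "0 \<le> t" "t < 1" "deg p \<le> d"
  shows "period_zeta p t \<le> exp (t * real d / (1 - t))"
proof -
  have "(\<Sum>m. t ^ Suc m * real (deg (p ^ Suc m)) / real (Suc m)) \<le> (\<Sum>m. t ^ Suc m * real d)"
  proof (rule suminf_le)
    fix m
    have "t ^ Suc m * real (deg (p ^ Suc m)) / real (Suc m) \<le> t ^ Suc m * real (deg p)"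
      by (rule zeta_term_bounds(2)[OF assms(1,2)])
    also have "\<dots> \<le> t ^ Suc m * real d" using assms by (intro mult_left_mono) auto
    finally show "t ^ Suc m * real (deg (p ^ Suc m)) / real (Suc m) \<le> t ^ Suc m * real d" .
  qed (use summable_zeta_terms[OF assms(1-3)] sums_summable[OF geometric_Suc_sums[OF assms(2,3)]] in auto)
  then show ?thesis
    using sums_unique[OF geometric_Suc_sums[OF assms(2,3)]] by (simp add: period_zeta_def)
qed

text \<open>All powers of \<open>p\<close> are nonzero and algebraic, hence of degree 1, so the
  exponent is the series of \<open>- ln (1 - t)\<close>.\<close>

lemma period_zeta_algebraic:
  assumes "algebraic p" "p \<noteq> 0" "0 \<le> t" "t < 1"
  shows "period_zeta p t = 1 / (1 - t)"
proof -
  have deg: "deg (p ^ k) = 1" for k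
    using period_algebraic[OF algebraic_power[OF assms(1), of k]] deg_pos[of "p ^ k"] assms(2) by force
  \<comment> \<open>The series expands the logarithm around 1 in powers of \<open>1 - t - 1\<close>,
    that is of \<open>- t\<close>; the alternating signs therefore cancel up to one overall
    minus.\<close>
  have "ln (1 - t) = (\<Sum>n. (- 1) ^ n * (1 / real (n + 1)) * (1 - t - 1) ^ Suc n)"
    using assms by (intro ln_series) auto
  also have "(\<lambda>n. (- 1) ^ n * (1 / real (n + 1)) * (1 - t - 1) ^ Suc n)
      = (\<lambda>n. - (t ^ Suc n * real (deg (p ^ Suc n)) / real (Suc n)))"
  proof
    fix n
    have "(- 1) ^ n * (- t) ^ Suc n = - t * ((- 1) * (- t)) ^ n"
      unfolding power_mult_distrib by simp
    then have "(- 1) ^ n * (- t) ^ Suc n = - (t ^ Suc n)" by simp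
    moreover have "(- 1) ^ n * (1 / real (n + 1)) * (1 - t - 1) ^ Suc n
        = ((- 1) ^ n * (- t) ^ Suc n) / real (Suc n)" by simp
    ultimately show "(- 1) ^ n * (1 / real (n + 1)) * (1 - t - 1) ^ Suc n
        = - (t ^ Suc n * real (deg (p ^ Suc n)) / real (Suc n))"
      unfolding deg by (simp only: minus_divide_left of_nat_1 mult_1_right)
  qed
  also have "(\<Sum>n. - (t ^ Suc n * real (deg (p ^ Suc n)) / real (Suc n)))
      = - (\<Sum>n. t ^ Suc n * real (deg (p ^ Suc n)) / real (Suc n))"
    by (rule suminf_minus[OF summable_zeta_terms[OF period_algebraic(1)[OF assms(1)] assms(3,4)]])
  finally have "period_zeta p t = exp (- ln (1 - t))" by (simp add: period_zeta_def)
  then show ?thesis using assms by (simp add: exp_minus inverse_eq_divide)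
qed

text \<open>Subadditivity of the degree is applied to each power \<open>(p * q) ^ Suc m\<close>, and
  the exponential turns the sum of the two series into the product.\<close>

lemma period_zeta_mult_le:
  assumes "period p" "period q" "0 \<le> t" "t < 1"
  shows "period_zeta (p * q) t \<le> period_zeta p t * period_zeta q t"
proof -
  let ?z = "\<lambda>p m. t ^ Suc m * real (deg (p ^ Suc m)) / real (Suc m)"
  have "(\<Sum>m. ?z (p * q) m) \<le> (\<Sum>m. ?z p m + ?z q m)"
  proof (rule suminf_le)
    fix m
    have "deg ((p * q) ^ Suc m) \<le> deg (p ^ Suc m) + deg (q ^ Suc m)"
      unfolding power_mult_distrib by (intro period_mult period_power assms)
    then have "real (deg ((p * q) ^ Suc m)) \<le> real (deg (p ^ Suc m)) + real (deg (q ^ Suc m))"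
      by linarith
    then have "?z (p * q) m \<le> t ^ Suc m * (real (deg (p ^ Suc m)) + real (deg (q ^ Suc m))) / real (Suc m)"
      using assms(3) by (intro divide_right_mono mult_left_mono) auto
    then show "?z (p * q) m \<le> ?z p m + ?z q m"
      by (simp only: distrib_left add_divide_distrib)
  qed (intro summable_zeta_terms summable_add period_mult assms)+
  also have "\<dots> = (\<Sum>m. ?z p m) + (\<Sum>m. ?z q m)"
    by (intro suminf_add[symmetric] summable_zeta_terms assms)
  finally show ?thesis by (simp add: period_zeta_def exp_add[symmetric])
qed

theorem theorem6p1:
  fixes t :: real and p p1 p2 :: complex
  assumes "0 \<le> t" and "t < 1"
    and "period p" and "period p1" and "period p2"
  shows "period_zeta 0 t = 1
    \<and> (algebraic p \<and> p \<noteq> 0 \<longrightarrow> period_zeta p t = 1 / (1 - t))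
    \<and> period_zeta (p1 * p2) t \<le> period_zeta p1 t * period_zeta p2 t
    \<and> period_zeta p t \<le> exp (t * real (deg p) / (1 - t))
    \<and> (deg p1 \<le> deg p2 \<longrightarrow> period_zeta (p1 + p2) t \<le> exp (t * real (deg p2) / (1 - t)))"
proof (intro conjI impI)
  show "period_zeta 0 t = 1" by (simp add: period_zeta_def)
  show "period_zeta p t = 1 / (1 - t)" if "algebraic p \<and> p \<noteq> 0"
    using that assms(1,2) by (intro period_zeta_algebraic) auto
  show "period_zeta (p1 * p2) t \<le> period_zeta p1 t * period_zeta p2 t"
    by (intro period_zeta_mult_le assms)
  show "period_zeta p t \<le> exp (t * real (deg p) / (1 - t))"
    by (intro period_zeta_le assms order_refl)
  show "period_zeta (p1 + p2) t \<le> exp (t * real (deg p2) / (1 - t))" if "deg p1 \<le> deg p2"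
    using period_add[OF assms(4,5)] that assms(1,2) by (intro period_zeta_le) auto
qed

end
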